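(* If $G$ is a graph isomorphic to a daisy cube (given without any embedding into a hypercube), then an isometric embedding of $G$ into a hypercube can be found in linear time.
   Context: Let $B=\{0,1\}$ and let $B^h$ be the set of binary words of length $h$. The hypercube $Q_h$ has vertex set $B^h$, two words being adjacent iff they differ in exactly one position. For $u,v\in B^h$ write $u\le v$ if $u_i\le v_i$ for all $i$. For $X\subseteq B^h$, the daisy cube $Q_h(X)$ is the subgraph of $Q_h$ induced by $\{v\in B^h : v\le x \text{ for some } x\in X\}$; a graph is a daisy cube if it is isomorphic to some $Q_h(X)$. A map $\alpha:V(G)\to B^h$ is an isometric embedding of $G$ into $Q_h$ if the Hamming distance between $\alpha(u)$ and $\alpha(v)$ equals $d_G(u,v)$ for all $u,v\in V(G)$. "Linear time" means time linear in the number of edges of $G$. *)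

theory Defs
  imports Main "HOL-Library.Extended_Nat"
begin

section \<open>Graphs and distances\<close>

record 'a graph =
  verts :: "'a set"
  edges :: "'a set set"

definition simple_graph :: "'a graph \<Rightarrow> bool" where
  "simple_graph G \<longleftrightarrow> finite (verts G) \<and>
     (\<forall>e \<in> edges G. \<exists>u \<in> verts G. \<exists>v \<in> verts G. u \<noteq> v \<and> e = {u, v})"

definition induced_subgraph :: "'a graph \<Rightarrow> 'a set \<Rightarrow> 'a graph" where
  "induced_subgraph G S = \<lparr>verts = verts G \<inter> S, edges = {e \<in> edges G. e \<subseteq> S}\<rparr>"

definition isomorphic :: "'a graph \<Rightarrow> 'b graph \<Rightarrow> bool" where
  "isomorphic G H \<longleftrightarrow> (\<exists>f. bij_betw f (verts G) (verts H) \<and>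
     (\<forall>u \<in> verts G. \<forall>v \<in> verts G. {u, v} \<in> edges G \<longleftrightarrow> {f u, f v} \<in> edges H))"

definition walk :: "'a graph \<Rightarrow> 'a \<Rightarrow> 'a list \<Rightarrow> 'a \<Rightarrow> bool" where
  "walk G u p v \<longleftrightarrow> p \<noteq> [] \<and> hd p = u \<and> last p = v \<and> set p \<subseteq> verts G \<and>
     (\<forall>i. Suc i < length p \<longrightarrow> {p ! i, p ! Suc i} \<in> edges G)"

text \<open>The distance is \<open>\<infinity>\<close> when no walk joins the two vertices.\<close>

definition gdist :: "'a graph \<Rightarrow> 'a \<Rightarrow> 'a \<Rightarrow> enat" where
  "gdist G u v = (INF p \<in> {p. walk G u p v}. enat (length p - 1))"


section \<open>Hypercubes and daisy cubes\<close>

definition words :: "nat \<Rightarrow> bool list set" where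
  "words h = {w. length w = h}"

text \<open>Only used for words of equal length.\<close>

definition hamming :: "bool list \<Rightarrow> bool list \<Rightarrow> nat" where
  "hamming u v = card {i. i < length u \<and> u ! i \<noteq> v ! i}"

definition hypercube :: "nat \<Rightarrow> bool list graph" where
  "hypercube h = \<lparr>verts = words h,
     edges = {{u, v} | u v. u \<in> words h \<and> v \<in> words h \<and> hamming u v = 1}\<rparr>"

definition daisy_cube :: "nat \<Rightarrow> bool list set \<Rightarrow> bool list graph" where
  "daisy_cube h X =
     induced_subgraph (hypercube h) {v \<in> words h. \<exists>x \<in> X. list_all2 (\<le>) v x}"

definition is_daisy_cube :: "'a graph \<Rightarrow> bool" where
  "is_daisy_cube G \<longleftrightarrow> (\<exists>h X. X \<subseteq> words h \<and> isomorphic G (daisy_cube h X))"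

definition isometric_embedding :: "'a graph \<Rightarrow> nat \<Rightarrow> ('a \<Rightarrow> bool list) \<Rightarrow> bool" where
  "isometric_embedding G h \<alpha> \<longleftrightarrow> (\<forall>v \<in> verts G. \<alpha> v \<in> words h) \<and>
     (\<forall>u \<in> verts G. \<forall>v \<in> verts G. enat (hamming (\<alpha> u) (\<alpha> v)) = gdist G u v)"


section \<open>Random access machine with unit costs\<close>

text \<open>
  A program has numbered registers and numbered arrays of natural numbers, initially zero
  apart from the input. The arithmetic is restricted to successor and truncated subtraction,
  so that a run of \<open>t\<close> steps only produces values linear in \<open>t\<close>, the input values and the
  constants of the program. Hence every value fits into a machine word of logarithmic length
  and charging one unit per command is realistic. Expressions may be nested, but their size
  is a constant of the program, so this affects running times by a constant factor only.
\<close>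

record state =
  reg :: "nat \<Rightarrow> nat"
  arr :: "nat \<Rightarrow> nat \<Rightarrow> nat"

datatype aexp =
    Const nat
  | Reg nat
  | Get nat aexp
  | Succ aexp
  | Sub aexp aexp

datatype bexp =
    Less aexp aexp
  | Equal aexp aexp
  | Neg bexp
  | Conj bexp bexp

datatype com =
    Skip
  | Assign nat aexp
  | Put nat aexp aexp
  | Seq com com
  | Ite bexp com com
  | While bexp com

primrec aval :: "aexp \<Rightarrow> state \<Rightarrow> nat" where
  "aval (Const k) s = k"
| "aval (Reg x) s = reg s x"
| "aval (Get a e) s = arr s a (aval e s)"
| "aval (Succ e) s = Suc (aval e s)"
| "aval (Sub e f) s = aval e s - aval f s"

primrec bval :: "bexp \<Rightarrow> state \<Rightarrow> bool" where
  "bval (Less e f) s \<longleftrightarrow> aval e s < aval f s"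
| "bval (Equal e f) s \<longleftrightarrow> aval e s = aval f s"
| "bval (Neg b) s \<longleftrightarrow> \<not> bval b s"
| "bval (Conj b b') s \<longleftrightarrow> bval b s \<and> bval b' s"

text \<open>\<open>exec c s t s'\<close>: started in \<open>s\<close>, the program \<open>c\<close> halts in \<open>s'\<close> after \<open>t\<close> steps.\<close>

inductive exec :: "com \<Rightarrow> state \<Rightarrow> nat \<Rightarrow> state \<Rightarrow> bool" where
  Skip: "exec Skip s 1 s"
| Assign: "exec (Assign x e) s 1 (s\<lparr>reg := (reg s)(x := aval e s)\<rparr>)"
| Put: "exec (Put a e f) s 1
    (s\<lparr>arr := (arr s)(a := (arr s a)(aval e s := aval f s))\<rparr>)"
| Seq: "exec c s t s' \<Longrightarrow> exec d s' t' s'' \<Longrightarrow> exec (Seq c d) s (t + t') s''"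
| IteTrue: "bval b s \<Longrightarrow> exec c s t s' \<Longrightarrow> exec (Ite b c d) s (1 + t) s'"
| IteFalse: "\<not> bval b s \<Longrightarrow> exec d s t s' \<Longrightarrow> exec (Ite b c d) s (1 + t) s'"
| WhileFalse: "\<not> bval b s \<Longrightarrow> exec (While b c) s 1 s"
| WhileTrue: "bval b s \<Longrightarrow> exec c s t s' \<Longrightarrow> exec (While b c) s' t' s'' \<Longrightarrow>
    exec (While b c) s (1 + t + t') s''"


section \<open>Input and output\<close>

text \<open>
  A list of lists is stored in two arrays: the concatenation of the lists, and the offsets at
  which they start, followed by the total length.
\<close>

definition offsets :: "'a list list \<Rightarrow> nat list" where
  "offsets xss = map (\<lambda>i. length (concat (take i xss))) [0..<Suc (length xss)]"

definition array_of :: "nat list \<Rightarrow> nat \<Rightarrow> nat" where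
  "array_of xs i = (if i < length xs then xs ! i else 0)"

definition stored_lists :: "state \<Rightarrow> nat \<Rightarrow> nat \<Rightarrow> nat list list \<Rightarrow> bool" where
  "stored_lists s a b xss \<longleftrightarrow>
     (\<forall>i < length (offsets xss). arr s a i = offsets xss ! i) \<and>
     (\<forall>i < length (concat xss). arr s b i = concat xss ! i)"

text \<open>The neighbours of a vertex may be listed in any order.\<close>

definition adjacency_lists :: "nat graph \<Rightarrow> nat list list \<Rightarrow> bool" where
  "adjacency_lists G adj \<longleftrightarrow> verts G = {..<length adj} \<and>
     (\<forall>u < length adj. distinct (adj ! u) \<and> set (adj ! u) = {v. {u, v} \<in> edges G})"

text \<open>
  The input consists of the number of vertices in register 0 and the adjacency lists in
  arrays 0 and 1.
\<close>

definition init_state :: "nat list list \<Rightarrow> state" where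
  "init_state adj =
     \<lparr>reg = (\<lambda>_. 0)(0 := length adj),
      arr = (\<lambda>_ _. 0)(0 := array_of (offsets adj), 1 := array_of (concat adj))\<rparr>"

text \<open>
  The output is the dimension \<open>h\<close> in register 0 and, for each vertex \<open>v\<close>, the list of the
  positions of the ones of \<open>\<alpha> v\<close>, in arrays 2 and 3. Writing out all \<open>h\<close> letters of every
  word would be impossible in linear time: a star with \<open>m\<close> edges is a daisy cube, and each
  of its isometric embeddings needs \<open>m + 1\<close> words of length at least \<open>m\<close>.
\<close>

definition outputs_map :: "state \<Rightarrow> nat \<Rightarrow> nat \<Rightarrow> (nat \<Rightarrow> bool list) \<Rightarrow> bool" where
  "outputs_map s n h \<alpha> \<longleftrightarrow> reg s 0 = h \<and>
     (\<exists>ones. length ones = n \<and>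
        (\<forall>v < n. distinct (ones ! v) \<and> set (ones ! v) = {i. i < h \<and> \<alpha> v ! i}) \<and>
        stored_lists s 2 3 ones)"

end

theory Submission
  imports Defs
begin

text \<open>
  Write the vertices of a daisy cube as finite sets forming a down-closed family, so that adjacent
  sets differ in one element. Breadth-first search from a root \<open>r\<close> yields the labels of all
  vertices: a neighbour of \<open>r\<close> is labelled by itself, and any other vertex by the union of the
  labels of two neighbours that are closer to \<open>r\<close>. Each label is at most as long as the degree if
  \<open>r = {}\<close>, but we do not know which vertex is \<open>{}\<close>, and for another vertex of maximum degree the
  total length of the labels need not be linear.

  Start instead from a vertex \<open>u\<close> of minimum degree. It lies below exactly one maximal set \<open>x\<close>,
  its neighbours arise by toggling the elements of \<open>x\<close>, and so the search from \<open>u\<close> computes the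
  difference between \<open>u\<close> and every vertex within \<open>x\<close>, in labels no longer than the minimum degree.
  At most half of the vertices contain a given element, so counting labels tells for
  each element of \<open>u\<close> whether it has a strict majority against it; removing these
  elements from \<open>u\<close> gives a vertex \<open>w\<close>. The remaining elements of \<open>w\<close> are contained in exactly half
  of the vertices, hence toggling them is an automorphism, and \<open>w\<close> is as good a root as \<open>{}\<close>. A
  second search from \<open>w\<close> labels every vertex by its difference from \<open>w\<close>.
\<close>

section \<open>Down-closed families of sets\<close>

locale down_closed =
  fixes n :: nat and f :: "nat \<Rightarrow> nat set"
  assumes n_pos: "0 < n"
    and finite_f: "v < n \<Longrightarrow> finite (f v)"
    and inj_f: "inj_on f {..<n}"
    and down: "v < n \<Longrightarrow> S \<subseteq> f v \<Longrightarrow> \<exists>u<n. f u = S"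
begin

definition sep :: "nat \<Rightarrow> nat \<Rightarrow> nat set" where
  "sep u v = sym_diff (f u) (f v)"

text \<open>The Hamming distance between the two sets. \<open>gdist_eq_dd\<close> identifies it with
  the distance in the graph.\<close>

definition dd :: "nat \<Rightarrow> nat \<Rightarrow> nat" where
  "dd u v = card (sep u v)"

definition nbrs :: "nat \<Rightarrow> nat set" where
  "nbrs v = {u. u < n \<and> dd v u = 1}"

definition dirs :: "nat \<Rightarrow> nat set" where
  "dirs v = {a. \<exists>u<n. sep v u = {a}}"

definition down_nbrs :: "nat \<Rightarrow> nat \<Rightarrow> nat set" where
  "down_nbrs r y = {p \<in> nbrs y. Suc (dd r p) = dd r y}"

text \<open>
  The neighbour \<open>v\<close> of the root \<open>r\<close> stands for the element in which they differ. The words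
  in the output thus have length \<open>n\<close>, with zeros at all positions that are not neighbours of \<open>r\<close>.
\<close>

definition label :: "nat \<Rightarrow> nat \<Rightarrow> nat set" where
  "label r y = {v \<in> nbrs r. sep r v \<subseteq> sep r y}"

section \<open>Symmetric differences and neighbours\<close>

lemma sep_eq_iff: "sep u v = S \<longleftrightarrow> f v = sym_diff (f u) S"
  unfolding sep_def by blast

lemma finite_sep: "u < n \<Longrightarrow> v < n \<Longrightarrow> finite (sep u v)"
  by (simp add: sep_def finite_f)

lemma sep_commute: "sep u v = sep v u"
  by (auto simp: sep_def)

lemma dd_commute: "dd u v = dd v u"
  by (simp add: dd_def sep_commute)

lemma sep_self [simp]: "sep u u = {}"
  by (simp add: sep_def)

lemma dd_self [simp]: "dd u u = 0"
  by (simp add: dd_def)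

lemma sep_chain: "sep u w = sym_diff (sep u v) (sep v w)"
  by (auto simp: sep_def)

lemma sep_eq_empty_iff: "u < n \<Longrightarrow> v < n \<Longrightarrow> sep u v = {} \<longleftrightarrow> u = v"
  using inj_onD[OF inj_f, of u v] by (auto simp: sep_def)

lemma dd_eq_0_iff: "u < n \<Longrightarrow> v < n \<Longrightarrow> dd u v = 0 \<longleftrightarrow> u = v"
  by (simp add: dd_def finite_sep sep_eq_empty_iff)

lemma sep_inj: "u < n \<Longrightarrow> v < n \<Longrightarrow> sep r u = sep r v \<Longrightarrow> u = v"
  using sep_chain[of u v r] sep_eq_empty_iff[of u v] by (simp add: sep_commute)

lemma nbrs_less: "u \<in> nbrs v \<Longrightarrow> u < n"
  by (simp add: nbrs_def)

lemma finite_nbrs [simp]: "finite (nbrs v)"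
  by (simp add: nbrs_def)

lemma nbrs_sym: "v < n \<Longrightarrow> u \<in> nbrs v \<Longrightarrow> v \<in> nbrs u"
  by (simp add: nbrs_def dd_commute)

lemma nbrsE:
  assumes "u \<in> nbrs v" obtains a where "sep v u = {a}"
  using assms by (auto simp: nbrs_def dd_def card_1_singleton_iff)

lemma nbrsI: "u < n \<Longrightarrow> sep v u = {a} \<Longrightarrow> u \<in> nbrs v"
  by (simp add: nbrs_def dd_def)

lemma dirsI: "u < n \<Longrightarrow> sep v u = {a} \<Longrightarrow> a \<in> dirs v"
  unfolding dirs_def by blast

lemma dirsE:
  assumes "a \<in> dirs v" obtains u where "u < n" "sep v u = {a}"
  using assms unfolding dirs_def by blast

text \<open>The degree counts the elements that can be toggled: a neighbour toggles exactly one
  element, and different neighbours toggle different ones because \<open>f\<close> is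
  injective.\<close>

lemma card_dirs: "v < n \<Longrightarrow> card (dirs v) = card (nbrs v)"
proof -
  assume v: "v < n"
  have "inj_on (sep v) (nbrs v)"
    by (rule inj_onI) (metis nbrs_less sep_inj)
  moreover have "sep v ` nbrs v = (\<lambda>a. {a}) ` dirs v" (is "?A = ?B")
  proof
    show "?A \<subseteq> ?B"
    proof
      fix s
      assume "s \<in> ?A"
      then obtain u where u: "u \<in> nbrs v" "s = sep v u" by blast
      obtain a where "sep v u = {a}"
        using u(1) by (rule nbrsE)
      then show "s \<in> ?B"
        using u nbrs_less[OF u(1)] by (auto simp: dirs_def)
    qed
    show "?B \<subseteq> ?A"
    proof
      fix s
      assume "s \<in> ?B"
      then obtain a where a: "s = {a}" "a \<in> dirs v" by blast
      obtain u where "u < n" "sep v u = {a}"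
        using a(2) by (rule dirsE)
      with a show "s \<in> ?A" using nbrsI[of u v a] by (metis imageI)
    qed
  qed
  ultimately show ?thesis
    by (metis card_image inj_singleton inj_on_subset subset_UNIV)
qed

lemma finite_dirs: "v < n \<Longrightarrow> finite (dirs v)"
proof -
  assume v: "v < n"
  have "dirs v \<subseteq> \<Union> (sep v ` {..<n})"
    by (auto simp: dirs_def)
  then show ?thesis
    by (rule finite_subset) (use v in \<open>auto simp: finite_sep\<close>)
qed

section \<open>Steps towards a root\<close>

lemma sep_toggle:
  assumes "sep y p = {a}"
  shows "sep r p = (if a \<in> sep r y then sep r y - {a} else insert a (sep r y))"
  using sep_chain[of r p y] assms by auto

lemma down_nbrsI:
  assumes "r < n" "y < n" "p < n" "sep y p = {a}" "a \<in> sep r y"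
  shows "p \<in> down_nbrs r y"
  using assms sep_toggle[OF assms(4), of r] card_Suc_Diff1[OF finite_sep[of r y]]
  by (simp add: down_nbrs_def nbrsI dd_def)

lemma down_nbrsE:
  assumes "r < n" "y < n" "p \<in> down_nbrs r y"
  obtains a where "p < n" "sep y p = {a}" "a \<in> sep r y" "sep r p = sep r y - {a}"
proof -
  have p: "p \<in> nbrs y" "Suc (dd r p) = dd r y"
    using assms(3) by (auto simp: down_nbrs_def)
  obtain a where a: "sep y p = {a}"
    using p(1) by (rule nbrsE)
  have "a \<in> sep r y"
    using assms(1,2) p(2) sep_toggle[OF a, of r] finite_sep[of r y]
    by (cases "a \<in> sep r y") (auto simp: dd_def)
  then show ?thesis
    using that[OF nbrs_less[OF p(1)] a] sep_toggle[OF a, of r] by simp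
qed

lemma down_nbrs_less: "p \<in> down_nbrs r y \<Longrightarrow> p < n"
  unfolding down_nbrs_def using nbrs_less by blast

text \<open>Toggling one element changes the size of a symmetric difference by exactly one, so no
  edge joins two vertices equally far from \<open>r\<close>.\<close>

lemma dd_nbrs:
  assumes "r < n" "y < n" "p \<in> nbrs y"
  shows "dd r p = Suc (dd r y) \<or> Suc (dd r p) = dd r y"
proof -
  obtain a where a: "sep y p = {a}"
    using assms(3) by (rule nbrsE)
  show ?thesis
    using sep_toggle[OF a, of r] card_Suc_Diff1[OF finite_sep[of r y], of a] finite_sep[of r y] assms
    by (auto simp: dd_def)
qed

text \<open>If \<open>f y \<subseteq> f r\<close>, an element of \<open>f r\<close> can be added to
  \<open>f y\<close> without leaving \<open>f r\<close>; otherwise an element outside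
  \<open>f r\<close> can be removed from \<open>f y\<close>. Either set is below a member of the
  family. Connectedness and the distance formula both rest on this.\<close>

lemma down_nbr_exists:
  assumes "r < n" "y < n" "y \<noteq> r"
  shows "down_nbrs r y \<noteq> {}"
proof -
  obtain a where a: "a \<in> sep r y"
    using assms sep_eq_empty_iff[of r y] by auto
  show ?thesis
  proof (cases "f y \<subseteq> f r")
    case True
    with a have "insert a (f y) \<subseteq> f r" "a \<notin> f y"
      by (auto simp: sep_def)
    then obtain p where "p < n" "f p = insert a (f y)"
      using down assms by blast
    then have "sep y p = {a}"
      using \<open>a \<notin> f y\<close> by (auto simp: sep_def)
    then show ?thesis
      using down_nbrsI[OF assms(1,2) \<open>p < n\<close> _ a] by blast
  next
    case False
    then obtain b where b: "b \<in> f y" "b \<notin> f r"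
      by blast
    then obtain p where p: "p < n" "f p = f y - {b}"
      using down[of y "f y - {b}"] assms by blast
    then have "sep y p = {b}" "b \<in> sep r y"
      using b by (auto simp: sep_def)
    then show ?thesis
      using down_nbrsI[OF assms(1,2) \<open>p < n\<close>] by blast
  qed
qed

section \<open>Labels and their recursion\<close>

lemma finite_label [simp]: "finite (label r y)"
  by (simp add: label_def)

lemma label_less: "v \<in> label r y \<Longrightarrow> v < n"
  unfolding label_def using nbrs_less by blast

lemma label_self: "r < n \<Longrightarrow> label r r = {}"
  by (auto simp: label_def elim!: nbrsE)

lemma label_nbr:
  assumes "r < n" "y \<in> nbrs r"
  shows "label r y = {y}"
proof -
  have "v = y" if "v \<in> nbrs r" "sep r v \<subseteq> sep r y" for v
  proof -
    have "sep r v = sep r y"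
      using that assms by (metis nbrsE subset_singleton_iff insert_not_empty)
    then show ?thesis
      using sep_inj[OF nbrs_less[OF that(1)] nbrs_less[OF assms(2)]] by blast
  qed
  then show ?thesis
    using assms(2) unfolding label_def by blast
qed

lemma label_down:
  assumes "r < n" "y < n" "p \<in> down_nbrs r y"
  shows "label r p \<subseteq> label r y"
  using down_nbrsE[OF assms] unfolding label_def by blast

text \<open>Passing to \<open>p\<close> and to \<open>q\<close> drops two different elements
  \<open>a\<close> and \<open>b\<close> from \<open>sep r y\<close>. A neighbour of \<open>r\<close>
  stands for a single element, which therefore survives in at least one of the two.\<close>

lemma label_Un:
  assumes "r < n" "y < n" "p \<in> down_nbrs r y" "q \<in> down_nbrs r y" "p \<noteq> q"
  shows "label r y = label r p \<union> label r q"
proof -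
  obtain a where a: "p < n" "sep y p = {a}" "a \<in> sep r y" "sep r p = sep r y - {a}"
    using down_nbrsE assms by blast
  obtain b where b: "q < n" "sep y q = {b}" "b \<in> sep r y" "sep r q = sep r y - {b}"
    using down_nbrsE assms by blast
  have "a \<noteq> b"
    using a b sep_inj assms(5) by metis
  show ?thesis
  proof
    show "label r p \<union> label r q \<subseteq> label r y"
      using label_down assms by blast
    show "label r y \<subseteq> label r p \<union> label r q"
    proof
      fix v
      assume "v \<in> label r y"
      then have v: "v \<in> nbrs r" "sep r v \<subseteq> sep r y"
        by (auto simp: label_def)
      obtain c where "sep r v = {c}"
        using v(1) by (rule nbrsE)
      with v show "v \<in> label r p \<union> label r q"
        using \<open>a \<noteq> b\<close> a(4) b(4) by (auto simp: label_def)
    qed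
  qed
qed

section \<open>Roots for which labelling works\<close>

text \<open>What the labelling program needs of its root: labels short enough for copying to be
  charged to the degrees, and a rule for vertices with only one closer neighbour, whose label is
  then simply copied.\<close>

definition good :: "nat \<Rightarrow> bool" where
  "good r \<longleftrightarrow> r < n \<and> (\<forall>y<n. card (label r y) \<le> card (nbrs y)) \<and>
     (\<forall>y<n. \<forall>p. 2 \<le> dd r y \<longrightarrow> down_nbrs r y = {p} \<longrightarrow> label r y = label r p)"

text \<open>One rule for both cases: the program remembers two closer neighbours that coincide only
  if there is just one, and then the union degenerates to a copy.\<close>

lemma label_good:
  assumes "good r" "y < n" "2 \<le> dd r y" "p \<in> down_nbrs r y" "q \<in> down_nbrs r y"
    "p = q \<longrightarrow> down_nbrs r y = {p}"
  shows "label r y = label r p \<union> label r q"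
  using assms label_Un[of r y p q] by (cases "p = q") (auto simp: good_def)

text \<open>Let the only closer neighbour of \<open>y\<close> differ from it in \<open>a\<close>. If
  \<open>a\<close> could be toggled at \<open>r\<close>, then \<open>two\<close> would supply
  \<open>b\<close> and with it a second closer neighbour. Hence no neighbour of \<open>r\<close>
  stands for \<open>a\<close>, and dropping \<open>a\<close> leaves the label unchanged.\<close>

lemma goodI:
  assumes r: "r < n" and card: "\<And>y. y < n \<Longrightarrow> card (label r y) \<le> card (nbrs y)"
    and two: "\<And>y a. y < n \<Longrightarrow> 2 \<le> dd r y \<Longrightarrow> a \<in> sep r y \<Longrightarrow> a \<in> dirs r \<Longrightarrow>
      \<exists>b \<in> sep r y. b \<noteq> a \<and> b \<in> dirs y"
  shows "good r"
  unfolding good_def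
proof (intro conjI allI impI)
  fix y p
  assume y: "y < n" "2 \<le> dd r y" and p: "down_nbrs r y = {p}"
  obtain a where a: "p < n" "sep y p = {a}" "a \<in> sep r y" "sep r p = sep r y - {a}"
    using down_nbrsE[OF r y(1)] p by blast
  have "a \<notin> dirs r"
  proof
    assume "a \<in> dirs r"
    then obtain b where b: "b \<in> sep r y" "b \<noteq> a" "b \<in> dirs y"
      using two y a by blast
    obtain q where "q < n" "sep y q = {b}"
      using b(3) by (rule dirsE)
    then have "q \<in> down_nbrs r y"
      using down_nbrsI r y b by blast
    then show False
      using p a \<open>sep y q = {b}\<close> b by auto
  qed
  then have "v \<in> label r p" if "v \<in> label r y" for v
  proof -
    have v: "v \<in> nbrs r" "sep r v \<subseteq> sep r y"
      using that by (auto simp: label_def)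
    obtain c where "sep r v = {c}"
      using v(1) by (rule nbrsE)
    with v show ?thesis
      using a(4) \<open>a \<notin> dirs r\<close> nbrs_less[of v r] by (auto simp: label_def dirs_def)
  qed
  then show "label r y = label r p"
    using label_down[OF r y(1), of p] p by blast
qed (use r card in auto)

section \<open>Vertices of minimum degree\<close>

text \<open>
  If \<open>x\<close> is a maximal set containing \<open>u\<close>, then \<open>x\<close> has degree \<open>card x\<close>, while every element of \<open>x\<close>
  can be toggled in \<open>u\<close>.
\<close>

lemma min_degree_dirs:
  assumes u: "u < n" and min: "\<forall>v<n. card (nbrs u) \<le> card (nbrs v)"
  obtains x where "x < n" "f u \<subseteq> f x" "dirs u = f x"
proof -
  let ?S = "{x. x < n \<and> f u \<subseteq> f x}"
  let ?m = "Max ((\<lambda>x. card (f x)) ` ?S)"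
  have fin: "finite ?S" and "?S \<noteq> {}"
    using u by auto
  then have "?m \<in> (\<lambda>x. card (f x)) ` ?S"
    by (intro Max_in) auto
  then obtain x where x: "x < n" "f u \<subseteq> f x" and m: "card (f x) = ?m"
    by force
  have max: "\<not> card (f x) < card (f z)" if "z < n" "f u \<subseteq> f z" for z
    using that fin unfolding m by (simp add: not_less)
  have sub: "f x \<subseteq> dirs u"
  proof
    fix a
    assume a: "a \<in> f x"
    have "sym_diff (f u) {a} \<subseteq> f x"
      using a x by auto
    then obtain p where "p < n" "f p = sym_diff (f u) {a}"
      using down x by blast
    then have "sep u p = {a}"
      by (auto simp: sep_def)
    then show "a \<in> dirs u"
      using \<open>p < n\<close> by (rule dirsI[rotated])
  qed
  have "dirs x \<subseteq> f x"
  proof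
    fix a
    assume "a \<in> dirs x"
    then obtain p where p: "p < n" "sep x p = {a}"
      by (rule dirsE)
    show "a \<in> f x"
    proof (rule ccontr)
      assume "a \<notin> f x"
      then have "f p = insert a (f x)"
        using p(2) by (simp add: sep_eq_iff)
      then show False
        using max[OF p(1)] x finite_f[OF x(1)] \<open>a \<notin> f x\<close> by auto
    qed
  qed
  \<comment> \<open>Minimality closes the chain \<open>card (f x) \<le> card (dirs u) \<le> card
    (dirs x) \<le> card (f x)\<close>.\<close>
  then have "card (dirs u) \<le> card (f x)"
    using min x card_dirs[OF u] card_dirs[OF x(1)] card_mono[OF finite_f[OF x(1)], of "dirs x"]
    by force
  then have "dirs u = f x"
    using card_seteq[OF finite_dirs[OF u] sub] by simp
  then show ?thesis
    using that x by blast
qed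

lemma card_label_le: "card (label r y) \<le> card (nbrs r)"
  by (rule card_mono) (auto simp: label_def)

lemma ex_other:
  assumes "2 \<le> card A" obtains b where "b \<in> A" "b \<noteq> a"
proof -
  have "\<not> A \<subseteq> {a}"
    using assms card_mono[of "{a}" A] by auto
  then show ?thesis
    using that by blast
qed

lemma diff_dirs:
  assumes "y < n" "b \<in> f y"
  shows "b \<in> dirs y"
proof -
  obtain p where p: "p < n" "f p = f y - {b}"
    using down[of y "f y - {b}"] assms by blast
  then have "sep y p = {b}"
    using assms by (auto simp: sep_def)
  then show ?thesis
    using p by (auto simp: dirs_def)
qed

text \<open>Labels consist of neighbours of \<open>u\<close>, whose number is minimal. For the
  second condition, if \<open>f y\<close> lies within \<open>f x\<close>, then all of
  \<open>sep u y\<close> can be toggled at \<open>y\<close>; otherwise some element of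
  \<open>f y\<close> outside \<open>f x = dirs u\<close> can be removed, and it differs from
  \<open>a\<close> because \<open>a\<close> is in \<open>dirs u\<close>.\<close>

lemma good_min_degree:
  assumes u: "u < n" and min: "\<forall>v<n. card (nbrs u) \<le> card (nbrs v)"
  shows "good u"
proof (rule goodI[OF u])
  fix y
  assume y: "y < n"
  show "card (label u y) \<le> card (nbrs y)"
    using card_label_le min y le_trans by blast
next
  fix y a
  assume y: "y < n" and y2: "2 \<le> dd u y" and a: "a \<in> sep u y" "a \<in> dirs u"
  obtain x where x: "x < n" "f u \<subseteq> f x" "dirs u = f x"
    by (rule min_degree_dirs[OF u min])
  show "\<exists>b \<in> sep u y. b \<noteq> a \<and> b \<in> dirs y"
  proof (cases "f y \<subseteq> f x")
    case True
    obtain b where b: "b \<in> sep u y" "b \<noteq> a"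
      using y2 unfolding dd_def by (rule ex_other)
    then have "sym_diff (f y) {b} \<subseteq> f x"
      using True x by (auto simp: sep_def)
    from down[OF x(1) this] obtain p where "p < n" "f p = sym_diff (f y) {b}"
      by auto
    then have "sep y p = {b}"
      by (simp add: sep_eq_iff)
    then have "b \<in> dirs y"
      using \<open>p < n\<close> by (rule dirsI[rotated])
    then show ?thesis
      using b by blast
  next
    case False
    then obtain b where b: "b \<in> f y" "b \<notin> f x"
      by blast
    then show ?thesis
      using diff_dirs[OF y] x a by (intro bexI[of _ b]) (auto simp: sep_def)
  qed
qed

section \<open>Central vertices\<close>

definition central :: "nat \<Rightarrow> bool" where
  "central w \<longleftrightarrow> w < n \<and> (\<forall>y<n. f w \<subseteq> dirs y)"

lemma sep_dirs_central:
  assumes "central w" "y < n"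
  shows "sep w y \<subseteq> dirs y"
  using assms diff_dirs by (auto simp: central_def sep_def)

text \<open>The elements of \<open>S\<close> are toggled one after the other, and centrality applies
  at each intermediate vertex. For \<open>S = f w\<close> this is the automorphism that exchanges
  \<open>w\<close> with the empty set.\<close>

lemma toggle_central:
  assumes w: "central w" and "y < n" "S \<subseteq> f w"
  shows "\<exists>z<n. f z = sym_diff (f y) S"
proof -
  have "finite S"
    using assms finite_f finite_subset by (auto simp: central_def)
  then show ?thesis
    using \<open>S \<subseteq> f w\<close>
  proof (induction S)
    case empty
    then show ?case using \<open>y < n\<close> by auto
  next
    case (insert a S)
    then obtain z where z: "z < n" "f z = sym_diff (f y) S"
      by auto
    have "a \<in> dirs z"
      using w insert.prems z by (auto simp: central_def)
    then obtain p where p: "p < n" "sep z p = {a}"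
      by (rule dirsE)
    have "f p = sym_diff (f z) {a}"
      using p(2) by (simp add: sep_eq_iff)
    also have "\<dots> = sym_diff (f y) (insert a S)"
      using insert.hyps by (auto simp: z)
    finally show ?case using p by blast
  qed
qed

text \<open>For \<open>a\<close> outside \<open>f w\<close>, the singleton \<open>{a}\<close> is in
  the family because \<open>a\<close> belongs to \<open>f y\<close>. Toggling all of
  \<open>f w\<close> in it produces the neighbour \<open>insert a (f w)\<close> of
  \<open>w\<close>.\<close>

lemma dirs_central:
  assumes w: "central w" and "y < n"
  shows "sep w y \<subseteq> dirs w"
proof
  fix a
  assume a: "a \<in> sep w y"
  have "w < n" using w by (simp add: central_def)
  show "a \<in> dirs w"
  proof (cases "a \<in> f w")
    case True
    then show ?thesis using diff_dirs \<open>w < n\<close> by blast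
  next
    case False
    then have "a \<in> f y" using a by (auto simp: sep_def)
    then obtain s where s: "s < n" "f s = {a}"
      using down[of y "{a}"] assms by auto
    obtain z where z: "z < n" "f z = sym_diff (f s) (f w)"
      using toggle_central[OF w s(1), of "f w"] by blast
    then have "sep w z = {a}"
      using s by (auto simp: sep_def)
    then show ?thesis using z by (auto simp: dirs_def)
  qed
qed

text \<open>Each element of \<open>sep w y\<close> has a neighbour of \<open>w\<close> standing for
  it, so the labels lose no information and their symmetric difference mirrors
  \<open>sep y z\<close>. This makes the final embedding isometric.\<close>

lemma card_sym_diff_label:
  assumes w: "central w" and y: "y < n" "z < n"
  shows "card (sym_diff (label w y) (label w z)) = dd y z"
proof -
  have "w < n" using w by (simp add: central_def)
  let ?S = "sym_diff (label w y) (label w z)"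
  have "inj_on (sep w) ?S"
    by (rule inj_onI) (metis Diff_iff Un_iff label_less sep_inj)
  moreover have "sep w ` ?S = (\<lambda>a. {a}) ` sep y z" (is "?A = ?B")
  proof
    show "?A \<subseteq> ?B"
    proof
      fix s
      assume "s \<in> ?A"
      then obtain v where v: "v \<in> nbrs w" "v \<in> ?S" "s = sep w v"
        by (auto simp: label_def)
      obtain a where a: "sep w v = {a}"
        using v(1) by (rule nbrsE)
      then have "a \<in> sep y z"
        using v sep_chain[of y z w] by (auto simp: label_def sep_commute[of y w])
      then show "s \<in> ?B"
        using v a by blast
    qed
    show "?B \<subseteq> ?A"
    proof
      fix b
      assume "b \<in> ?B"
      then obtain a where a: "b = {a}" "a \<in> sep y z" by blast
      then have a': "a \<in> sym_diff (sep w y) (sep w z)"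
        using sep_chain[of y z w] by (simp add: sep_commute[of y w])
      then have "a \<in> dirs w"
        using dirs_central[OF w] y by blast
      then obtain v where "v < n" "sep w v = {a}"
        by (rule dirsE)
      then have "v \<in> ?S"
        using a' nbrsI[of v w a] by (auto simp: label_def)
      then show "b \<in> ?A"
        using a \<open>sep w v = {a}\<close> by blast
    qed
  qed
  ultimately show ?thesis
    unfolding dd_def by (metis card_image inj_singleton inj_on_subset subset_UNIV)
qed

lemma good_central:
  assumes w: "central w"
  shows "good w"
proof (rule goodI)
  show "w < n" using w by (simp add: central_def)
  fix y
  assume y: "y < n"
  \<comment> \<open>With \<open>z = w\<close>, whose label is empty, the label of \<open>y\<close>
    has \<open>dd w y\<close> elements, and all of \<open>sep w y\<close> can be toggled at
    \<open>y\<close>.\<close>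
  show "card (label w y) \<le> card (nbrs y)"
    using card_sym_diff_label[OF w y \<open>w < n\<close>] label_self[OF \<open>w < n\<close>]
      card_mono[OF finite_dirs[OF y] sep_dirs_central[OF w y]] card_dirs[OF y]
    by (simp add: dd_def sep_commute)
next
  fix y a
  assume y: "y < n" and y2: "2 \<le> dd w y"
  obtain b where "b \<in> sep w y" "b \<noteq> a"
    using y2 unfolding dd_def by (rule ex_other)
  then show "\<exists>b \<in> sep w y. b \<noteq> a \<and> b \<in> dirs y"
    using sep_dirs_central[OF w y] by blast
qed

section \<open>Majority votes and the choice of the second root\<close>

text \<open>If \<open>v\<close> is the neighbour of \<open>u\<close> that toggles \<open>a\<close>,
  this is the number of vertices that disagree with \<open>u\<close> about \<open>a\<close>.\<close>

definition hits :: "nat \<Rightarrow> nat \<Rightarrow> nat" where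
  "hits u v = card {y. y < n \<and> v \<in> label u y}"

text \<open>Equality of the sizes means that all of \<open>sep u y\<close> can be toggled at
  \<open>u\<close>, so that the label is complete. The test on \<open>hits\<close> is a strict
  majority, phrased without addition because the machine has none.\<close>

definition candidate :: "nat \<Rightarrow> nat \<Rightarrow> bool" where
  "candidate u y \<longleftrightarrow> y < n \<and> card (label u y) = dd u y \<and>
     (\<forall>v \<in> label u y. n - hits u v < hits u v)"

text \<open>Removing \<open>a\<close> maps the sets with \<open>a\<close> injectively to sets
  without it. In case of a tie this injection is onto, so that \<open>a\<close> can also be added to
  every set without it.\<close>

lemma card_without_le:
  "card {y. y < n \<and> a \<in> f y} \<le> card {y. y < n \<and> a \<notin> f y}"
  and closed_if_tie:
  "card {y. y < n \<and> a \<notin> f y} \<le> card {y. y < n \<and> a \<in> f y} \<Longrightarrow> y < n \<Longrightarrow> a \<in> dirs y"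
proof -
  let ?A = "{y. y < n \<and> a \<in> f y}" and ?B = "{y. y < n \<and> a \<notin> f y}"
  have "\<forall>y\<in>?A. \<exists>z<n. f z = f y - {a}"
    using down by blast
  from bchoice[OF this] obtain g where "\<forall>y\<in>?A. g y < n \<and> f (g y) = f y - {a}" ..
  then have g: "g y < n \<and> f (g y) = f y - {a}" if "y \<in> ?A" for y
    using that by (rule bspec)
  have inj: "inj_on g ?A"
  proof (rule inj_onI)
    fix y z
    assume yz: "y \<in> ?A" "z \<in> ?A" "g y = g z"
    then have "f y - {a} = f z - {a}"
      using g by metis
    then have "f y = f z"
      using yz by blast
    then show "y = z"
      using yz inj_f by (auto dest: inj_onD)
  qed
  have sub: "g ` ?A \<subseteq> ?B"
    using g by auto
  show "card ?A \<le> card ?B"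
    using card_inj_on_le[OF inj sub] by simp
  assume le: "card ?B \<le> card ?A" and y: "y < n"
  have eq: "g ` ?A = ?B"
    using card_seteq[OF _ sub] le card_image[OF inj] by simp
  show "a \<in> dirs y"
  proof (cases "a \<in> f y")
    case True
    then show ?thesis using diff_dirs y by blast
  next
    case False
    then obtain z where "z \<in> ?A" "y = g z"
      using eq y by blast
    then have "z < n" "sep y z = {a}"
      using g[of z] by (auto simp: sep_def)
    then show ?thesis by (auto simp: dirs_def)
  qed
qed

text \<open>A candidate arises from \<open>u\<close> by removing elements that have a strict
  majority against them, and a farthest one removes them all. The elements left in
  \<open>f w\<close> are then in a tie, and \<open>closed_if_tie\<close> applies.\<close>

lemma central_candidate:
  assumes u: "u < n" and min: "\<forall>v<n. card (nbrs u) \<le> card (nbrs v)"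
    and w: "candidate u w" and far: "\<And>y. candidate u y \<Longrightarrow> dd u y \<le> dd u w"
  shows "central w"
proof -
  obtain x where x: "x < n" "f u \<subseteq> f x" "dirs u = f x"
    by (rule min_degree_dirs[OF u min])
  let ?A = "\<lambda>a. {y. y < n \<and> a \<in> f y}" and ?B = "\<lambda>a. {y. y < n \<and> a \<notin> f y}"
  define maj where "maj a \<longleftrightarrow> card (?A a) < card (?B a)" for a
  have AB: "card (?A a) + card (?B a) = n" for a
  proof -
    have "?A a \<union> ?B a = {..<n}" by auto
    moreover have "card (?A a \<union> ?B a) = card (?A a) + card (?B a)"
      by (rule card_Un_disjoint) auto
    ultimately show ?thesis by simp
  qed
  \<comment> \<open>If \<open>a\<close> is in \<open>f u\<close>, then \<open>hits\<close> counts
    the sets without \<open>a\<close>. Otherwise it counts those with \<open>a\<close>, at most half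
    of all, and the test fails.\<close>
  have maj: "n - hits u v < hits u v \<longleftrightarrow> a \<in> f u \<and> maj a" if "v \<in> nbrs u" "sep u v = {a}" for v a
  proof -
    have "v \<in> label u y \<longleftrightarrow> a \<in> sep u y" for y
      using that by (simp add: label_def)
    then have lab: "v \<in> label u y \<longleftrightarrow> (a \<in> f u \<longleftrightarrow> a \<notin> f y)" for y
      by (auto simp: sep_def)
    show ?thesis
    proof (cases "a \<in> f u")
      case True
      then have "hits u v = card (?B a)"
        by (simp add: hits_def lab)
      then show ?thesis
        using True AB[of a] unfolding maj_def by linarith
    next
      case False
      then have "hits u v = card (?A a)"
        by (simp add: hits_def lab)
      then show ?thesis
        using False AB[of a] card_without_le[of a] by linarith
    qed
  qed
  have cand: "candidate u y \<longleftrightarrow> (\<forall>a \<in> sep u y. a \<in> f u \<and> maj a)" if y: "y < n" for y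
  proof -
    have inj: "inj_on (sep u) (label u y)"
      by (rule inj_onI) (metis label_less sep_inj)
    have img: "sep u ` label u y = (\<lambda>a. {a}) ` (sep u y \<inter> dirs u)"
    proof (intro equalityI subsetI)
      fix s
      assume "s \<in> sep u ` label u y"
      then obtain v where v: "v \<in> nbrs u" "sep u v \<subseteq> sep u y" "s = sep u v"
        by (auto simp: label_def)
      obtain a where "sep u v = {a}"
        using v(1) by (rule nbrsE)
      with v show "s \<in> (\<lambda>a. {a}) ` (sep u y \<inter> dirs u)"
        using nbrs_less[of v u] by (auto simp: dirs_def)
    next
      fix s
      assume "s \<in> (\<lambda>a. {a}) ` (sep u y \<inter> dirs u)"
      then obtain a where a: "a \<in> sep u y" "a \<in> dirs u" "s = {a}"
        by blast
      obtain v where "v < n" "sep u v = {a}"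
        using a(2) by (rule dirsE)
      then have "v \<in> label u y" "s = sep u v"
        using a nbrsI[of v u a] by (auto simp: label_def)
      then show "s \<in> sep u ` label u y"
        by blast
    qed
    have eq: "card (label u y) = card (sep u y \<inter> dirs u)"
      using img card_image[OF inj] by (metis card_image inj_singleton inj_on_subset subset_UNIV)
    have "card (label u y) = dd u y \<longleftrightarrow> sep u y \<subseteq> dirs u"
    proof
      assume "card (label u y) = dd u y"
      then have "sep u y \<inter> dirs u = sep u y"
        using card_subset_eq[OF finite_sep[OF u y], of "sep u y \<inter> dirs u"] eq
        by (simp add: dd_def)
      then show "sep u y \<subseteq> dirs u"
        by blast
    next
      assume "sep u y \<subseteq> dirs u"
      then have "sep u y \<inter> dirs u = sep u y"
        by blast
      then show "card (label u y) = dd u y"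
        using eq by (simp add: dd_def)
    qed
    moreover have "(\<forall>v \<in> label u y. n - hits u v < hits u v) \<longleftrightarrow>
        (\<forall>a \<in> sep u y \<inter> dirs u. a \<in> f u \<and> maj a)"
    proof -
      have "n - hits u v < hits u v \<longleftrightarrow> (\<forall>a. sep u v = {a} \<longrightarrow> a \<in> f u \<and> maj a)"
        if "v \<in> label u y" for v
      proof -
        have v: "v \<in> nbrs u"
          using that by (simp add: label_def)
        then obtain a where a: "sep u v = {a}"
          by (rule nbrsE)
        show ?thesis
          using maj[OF v a] a by simp
      qed
      then have "(\<forall>v \<in> label u y. n - hits u v < hits u v) \<longleftrightarrow>
          (\<forall>v \<in> label u y. \<forall>a. sep u v = {a} \<longrightarrow> a \<in> f u \<and> maj a)"
        by (rule ball_cong[OF refl])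
      also have "\<dots> \<longleftrightarrow> (\<forall>s \<in> sep u ` label u y. \<forall>a. s = {a} \<longrightarrow> a \<in> f u \<and> maj a)"
        by (simp only: ball_simps)
      also have "\<dots> \<longleftrightarrow> (\<forall>a \<in> sep u y \<inter> dirs u. a \<in> f u \<and> maj a)"
        unfolding img by (simp only: ball_simps) auto
      finally show ?thesis .
    qed
    \<comment> \<open>Elements of \<open>f u\<close> lie in \<open>f x = dirs u\<close>, so the test
      on the sizes follows from the majority condition.\<close>
    moreover have "sep u y \<subseteq> dirs u" if "\<forall>a \<in> sep u y. a \<in> f u"
      using that x by blast
    ultimately show ?thesis
      unfolding candidate_def using y by blast
  qed
  \<comment> \<open>The extreme candidate, from which every element with a majority against it has
    been removed; \<open>w\<close> turns out to be \<open>z\<close>.\<close>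
  obtain z where z: "z < n" "f z = f u - {a \<in> f u. maj a}"
    using down[OF u, of "f u - {a \<in> f u. maj a}"] by auto
  have sz: "sep u z = {a \<in> f u. maj a}"
    using z by (auto simp: sep_def)
  have wn: "w < n" using w by (simp add: candidate_def)
  have "candidate u z"
    using cand[OF z(1)] sz by auto
  moreover have "sep u w \<subseteq> sep u z"
    using cand[OF wn] w sz by auto
  ultimately have "sep u w = sep u z"
    using far[of z] card_seteq[OF finite_sep[OF u z(1)], of "sep u w"] by (simp add: dd_def)
  then have "w = z"
    by (rule sep_inj[OF wn z(1)])
  then have "\<not> maj a" if "a \<in> f w" for a
    using that z by auto
  then have "f w \<subseteq> dirs y" if "y < n" for y
    using closed_if_tie that by (auto simp: maj_def not_less)
  then show ?thesis
    using wn by (simp add: central_def)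
qed

text \<open>By connectedness every vertex except \<open>0\<close> has a neighbour closer to
  \<open>0\<close>. This turns time linear in the number of vertices into time linear in the number
  of edges.\<close>

lemma n_le_sum_degrees: "n \<le> (\<Sum>v<n. card (nbrs v)) + 1"
proof -
  have "1 \<le> card (nbrs v)" if "v \<in> {..<n} - {0}" for v
  proof -
    have "down_nbrs 0 v \<noteq> {}"
      using down_nbr_exists that n_pos by auto
    then have "nbrs v \<noteq> {}" by (auto simp: down_nbrs_def)
    then show ?thesis by (simp add: Suc_le_eq card_gt_0_iff)
  qed
  then have "(\<Sum>v\<in>{..<n} - {0}. 1) \<le> (\<Sum>v\<in>{..<n} - {0}. card (nbrs v))"
    by (rule sum_mono)
  also have "\<dots> \<le> (\<Sum>v<n. card (nbrs v))"
    by (rule sum_mono2) auto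
  finally show ?thesis using n_pos by simp
qed

lemma candidate_root: "u < n \<Longrightarrow> candidate u u"
  by (simp add: candidate_def label_self)

end

section \<open>Programs\<close>

definition runs :: "com \<Rightarrow> state \<Rightarrow> nat \<Rightarrow> (state \<Rightarrow> bool) \<Rightarrow> bool" where
  "runs c s T Q \<longleftrightarrow> (\<exists>t s'. exec c s t s' \<and> t \<le> T \<and> Q s')"

inductive_cases exec_SkipE: "exec Skip s t s'"
inductive_cases exec_AssignE: "exec (Assign x e) s t s'"
inductive_cases exec_PutE: "exec (Put a e e') s t s'"
inductive_cases exec_SeqE: "exec (Seq c d) s t s'"
inductive_cases exec_IteE: "exec (Ite b c d) s t s'"

lemmas exec_Skip = exec.Skip[unfolded One_nat_def]
lemmas exec_Assign = exec.Assign[unfolded One_nat_def]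
lemmas exec_Put = exec.Put[unfolded One_nat_def]

lemmas exec_Ite = exec.IteTrue[simplified] exec.IteFalse[simplified]

lemma runs_Skip [simp]: "runs Skip s T Q \<longleftrightarrow> 1 \<le> T \<and> Q s"
  unfolding runs_def by (auto elim: exec_SkipE intro!: exec_Skip)

lemma runs_Assign [simp]:
  "runs (Assign x e) s T Q \<longleftrightarrow> 1 \<le> T \<and> Q (s\<lparr>reg := (reg s)(x := aval e s)\<rparr>)"
  unfolding runs_def by (auto elim: exec_AssignE intro!: exec_Assign)

lemma runs_Put [simp]:
  "runs (Put a e e') s T Q \<longleftrightarrow>
     1 \<le> T \<and> Q (s\<lparr>arr := (arr s)(a := (arr s a)(aval e s := aval e' s))\<rparr>)"
  unfolding runs_def by (auto elim: exec_PutE intro!: exec_Put)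

lemma runs_Ite [simp]:
  "runs (Ite b c d) s T Q \<longleftrightarrow>
     1 \<le> T \<and> (if bval b s then runs c s (T - 1) Q else runs d s (T - 1) Q)"
proof
  assume "runs (Ite b c d) s T Q"
  then obtain t s' where "exec (Ite b c d) s t s'" "t \<le> T" "Q s'"
    by (auto simp: runs_def)
  then show "1 \<le> T \<and> (if bval b s then runs c s (T - 1) Q else runs d s (T - 1) Q)"
    by (elim exec_IteE) (auto simp: runs_def intro!: exI[of _ "t - 1"] exI[of _ s'])
next
  assume T: "1 \<le> T \<and> (if bval b s then runs c s (T - 1) Q else runs d s (T - 1) Q)"
  then obtain t s' where "if bval b s then exec c s t s' else exec d s t s'" "t \<le> T - 1" "Q s'"
    by (auto simp: runs_def split: if_splits)
  then have "exec (Ite b c d) s (1 + t) s'" "1 + t \<le> T" "Q s'"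
    using T by (auto intro: exec_Ite split: if_splits)
  then show "runs (Ite b c d) s T Q"
    unfolding runs_def by blast
qed

lemma runs_SeqI:
  assumes "runs c s T P" "\<And>s'. P s' \<Longrightarrow> runs d s' T' Q" "T + T' \<le> U"
  shows "runs (Seq c d) s U Q"
proof -
  obtain t s' where c: "exec c s t s'" "t \<le> T" "P s'"
    using assms(1) by (auto simp: runs_def)
  obtain t' s'' where d: "exec d s' t' s''" "t' \<le> T'" "Q s''"
    using assms(2)[OF c(3)] by (auto simp: runs_def)
  have "t + t' \<le> U"
    using assms(3) c d by linarith
  then show ?thesis
    using exec.Seq[OF c(1) d(1)] d(3) unfolding runs_def by blast
qed

lemma runs_Seq_iff: "runs (Seq c d) s T Q \<longleftrightarrow> (\<exists>t\<le>T. \<exists>s'. exec c s t s' \<and> runs d s' (T - t) Q)"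
proof
  assume "runs (Seq c d) s T Q"
  then obtain u s2 where u: "exec (Seq c d) s u s2" "u \<le> T" "Q s2"
    by (auto simp: runs_def)
  from u(1) obtain t s1 t' where "u = t + t'" "exec c s t s1" "exec d s1 t' s2"
    by (rule exec_SeqE)
  moreover from this u have "runs d s1 (T - t) Q"
    unfolding runs_def by (intro exI[of _ t'] exI[of _ s2]) simp
  ultimately show "\<exists>t\<le>T. \<exists>s'. exec c s t s' \<and> runs d s' (T - t) Q"
    using u(2) by (intro exI[of _ t] conjI exI[of _ s1]) simp_all
next
  assume "\<exists>t\<le>T. \<exists>s'. exec c s t s' \<and> runs d s' (T - t) Q"
  then obtain t s' where "t \<le> T" "exec c s t s'" "runs d s' (T - t) Q"
    by blast
  then show "runs (Seq c d) s T Q"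
    by (intro runs_SeqI[of c s t "\<lambda>x. x = s'" d "T - t"]) (auto simp: runs_def)
qed

text \<open>Together with the rules for single commands, this and the next rule let the simplifier
  execute code without loops symbolically while it deducts the time.\<close>

lemma runs_Seq_Assign [simp]:
  "runs (Seq (Assign x e) d) s T Q \<longleftrightarrow>
     1 \<le> T \<and> runs d (s\<lparr>reg := (reg s)(x := aval e s)\<rparr>) (T - 1) Q"
  unfolding runs_Seq_iff by (auto elim: exec_AssignE intro!: exec_Assign)

lemma runs_Seq_Put [simp]:
  "runs (Seq (Put a e e') d) s T Q \<longleftrightarrow>
     1 \<le> T \<and> runs d (s\<lparr>arr := (arr s)(a := (arr s a)(aval e s := aval e' s))\<rparr>) (T - 1) Q"
  unfolding runs_Seq_iff by (auto elim: exec_PutE intro!: exec_Put)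

lemma runs_mono:
  "runs c s T Q \<Longrightarrow> T \<le> T' \<Longrightarrow> (\<And>s'. Q s' \<Longrightarrow> Q' s') \<Longrightarrow> runs c s T' Q'"
  unfolding runs_def by (meson le_trans)

section \<open>Frame conditions\<close>

primrec rmods :: "com \<Rightarrow> nat set" where
  "rmods Skip = {}"
| "rmods (Assign x e) = {x}"
| "rmods (Put a e e') = {}"
| "rmods (Seq c d) = rmods c \<union> rmods d"
| "rmods (Ite b c d) = rmods c \<union> rmods d"
| "rmods (While b c) = rmods c"

primrec amods :: "com \<Rightarrow> nat set" where
  "amods Skip = {}"
| "amods (Assign x e) = {}"
| "amods (Put a e e') = {a}"
| "amods (Seq c d) = amods c \<union> amods d"
| "amods (Ite b c d) = amods c \<union> amods d"
| "amods (While b c) = amods c"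

text \<open>A frame condition read off from the syntax, which keeps untouched registers and arrays
  out of the loop invariants.\<close>

definition same :: "com \<Rightarrow> state \<Rightarrow> state \<Rightarrow> bool" where
  "same c s s' \<longleftrightarrow> (\<forall>x. x \<notin> rmods c \<longrightarrow> reg s' x = reg s x) \<and> (\<forall>a. a \<notin> amods c \<longrightarrow> arr s' a = arr s a)"

lemma same_reg: "same c s s' \<Longrightarrow> x \<notin> rmods c \<Longrightarrow> reg s' x = reg s x"
  and same_arr: "same c s s' \<Longrightarrow> a \<notin> amods c \<Longrightarrow> arr s' a = arr s a"
  by (auto simp: same_def)

lemma exec_same: "exec c s t s' \<Longrightarrow> same c s s'"
  by (induction rule: exec.induct) (auto simp: same_def)

lemma runs_same: "runs c s T Q \<Longrightarrow> runs c s T (\<lambda>s'. Q s' \<and> same c s s')"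
  unfolding runs_def using exec_same by blast

lemma runs_SeqI_same:
  assumes "runs c s T P" "\<And>s'. P s' \<Longrightarrow> same c s s' \<Longrightarrow> runs d s' T' Q" "T + T' \<le> U"
  shows "runs (Seq c d) s U Q"
  using runs_SeqI[OF runs_same[OF assms(1)], of d T' Q U] assms(2,3) by blast

section \<open>Counting loops\<close>

text \<open>The limit \<open>e'\<close> is evaluated anew before each iteration, hence the
  assumption \<open>bound\<close> in the rules below.\<close>

definition For :: "nat \<Rightarrow> aexp \<Rightarrow> aexp \<Rightarrow> com \<Rightarrow> com" where
  "For x e e' c = Seq (Assign x e) (While (Less (Reg x) e') (Seq c (Assign x (Succ (Reg x)))))"

lemma rmods_For [simp]: "rmods (For x e e' c) = insert x (rmods c)"
  and amods_For [simp]: "amods (For x e e' c) = amods c"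
  by (auto simp: For_def)

text \<open>The parameter \<open>\<tau>\<close> of the invariant is the time spent so far: the cost of an iteration may
  depend on the state in which it starts.\<close>

lemma runs_For_time:
  fixes c :: com and I :: "nat \<Rightarrow> nat \<Rightarrow> state \<Rightarrow> bool"
  assumes fresh: "x \<notin> rmods c" and ab: "aval e s = a" "a \<le> b"
    and init: "I a 0 (s\<lparr>reg := (reg s)(x := a)\<rparr>)"
    and bound: "\<And>s'. same (For x e e' c) s s' \<Longrightarrow> aval e' s' = b"
    and step: "\<And>i \<tau> s'. a \<le> i \<Longrightarrow> i < b \<Longrightarrow> reg s' x = i \<Longrightarrow> I i \<tau> s' \<Longrightarrow> same (For x e e' c) s s' \<Longrightarrow>
      \<exists>K. runs c s' K (\<lambda>s''. I (Suc i) (\<tau> + K + 2) (s''\<lparr>reg := (reg s'')(x := Suc i)\<rparr>))"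
    and final: "\<And>s' \<tau>. reg s' x = b \<Longrightarrow> I b \<tau> s' \<Longrightarrow> same (For x e e' c) s s' \<Longrightarrow> Q s' \<and> \<tau> + 2 \<le> U"
  shows "runs (For x e e' c) s U Q"
proof -
  let ?W = "While (Less (Reg x) e') (Seq c (Assign x (Succ (Reg x))))"
  let ?F = "For x e e' c"
  \<comment> \<open>Downward induction from \<open>b\<close>. Here \<open>\<tau>'\<close> is the
    final value of the time parameter; of the two further units in \<open>U\<close>, one pays for
    the failing test and one for the initial assignment. Likewise each iteration adds two units to
    \<open>K\<close>, for its test and its increment.\<close>
  have loop: "\<exists>\<tau>'\<ge>\<tau>. \<tau>' + 2 \<le> U \<and> runs ?W s' (\<tau>' - \<tau> + 1) Q"
    if "k \<le> b" "a \<le> k" "reg s' x = k" "I k \<tau> s'" "same ?F s s'" for k s' \<tau>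
    using that
  proof (induction k arbitrary: s' \<tau> rule: inc_induct)
    case base
    then have "\<not> bval (Less (Reg x) e') s'"
      using bound by simp
    then have "runs ?W s' 1 Q"
      using final[OF base(2,3,4)] unfolding runs_def
      by (intro exI[of _ 1] exI[of _ s']) (simp add: exec.WhileFalse del: One_nat_def)
    then show ?case
      using final[OF base(2,3,4)] by (intro exI[of _ \<tau>]) simp
  next
    case (step k)
    from assms(6)[OF step.prems(1) step.hyps(2) step.prems(2-4)] obtain K where
      "runs c s' K (\<lambda>s''. I (Suc k) (\<tau> + K + 2) (s''\<lparr>reg := (reg s'')(x := Suc k)\<rparr>))" ..
    then have "runs c s' K (\<lambda>s''. I (Suc k) (\<tau> + K + 2) (s''\<lparr>reg := (reg s'')(x := Suc k)\<rparr>) \<and> same c s' s'')"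
      by (rule runs_same)
    then obtain t s1 where t: "exec c s' t s1" "t \<le> K"
      "I (Suc k) (\<tau> + K + 2) (s1\<lparr>reg := (reg s1)(x := Suc k)\<rparr>)" "same c s' s1"
      unfolding runs_def by blast
    let ?s2 = "s1\<lparr>reg := (reg s1)(x := aval (Succ (Reg x)) s1)\<rparr>"
    have x: "aval (Succ (Reg x)) s1 = Suc k"
      using same_reg[OF t(4) fresh] step.prems by simp
    have body: "exec (Seq c (Assign x (Succ (Reg x)))) s' (t + 1) ?s2"
      using exec.Seq[OF t(1) exec.Assign] .
    have "\<exists>\<tau>'\<ge>\<tau> + K + 2. \<tau>' + 2 \<le> U \<and> runs ?W ?s2 (\<tau>' - (\<tau> + K + 2) + 1) Q"
    proof (rule step.IH)
      show "same ?F s ?s2"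
        using step.prems(4) t(4) by (auto simp: same_def)
    qed (use x t step.prems in auto)
    then obtain \<tau>' t' s3 where \<tau>': "\<tau> + K + 2 \<le> \<tau>'" "\<tau>' + 2 \<le> U"
      and t': "exec ?W ?s2 t' s3" "t' \<le> \<tau>' - (\<tau> + K + 2) + 1" "Q s3"
      unfolding runs_def by blast
    have "bval (Less (Reg x) e') s'"
      using bound[OF step.prems(4)] step by simp
    then have "exec ?W s' (1 + (t + 1) + t') s3"
      using body t'(1) by (rule exec.WhileTrue)
    moreover have "1 + (t + 1) + t' \<le> \<tau>' - \<tau> + 1"
      using t(2) t'(2) \<tau>' by linarith
    ultimately have "runs ?W s' (\<tau>' - \<tau> + 1) Q"
      using t'(3) unfolding runs_def by blast
    then show ?case
      using \<tau>' by (intro exI[of _ \<tau>']) simp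
  qed
  let ?s0 = "s\<lparr>reg := (reg s)(x := a)\<rparr>"
  have "\<exists>\<tau>'\<ge>0. \<tau>' + 2 \<le> U \<and> runs ?W ?s0 (\<tau>' - 0 + 1) Q"
    by (rule loop) (use ab init in \<open>auto simp: same_def\<close>)
  then obtain \<tau>' where "\<tau>' + 2 \<le> U" "runs ?W ?s0 (\<tau>' + 1) Q"
    by auto
  then show ?thesis
    unfolding For_def by (auto simp: ab intro: runs_mono)
qed

text \<open>The case in which the cost of an iteration is bounded in terms of the index alone; the
  time spent is then a partial sum of \<open>T\<close>.\<close>

lemma runs_For:
  assumes fresh: "x \<notin> rmods c" and ab: "aval e s = a" "a \<le> b"
    and init: "I a (s\<lparr>reg := (reg s)(x := a)\<rparr>)"
    and bound: "\<And>s'. same (For x e e' c) s s' \<Longrightarrow> aval e' s' = b"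
    and step: "\<And>i s'. a \<le> i \<Longrightarrow> i < b \<Longrightarrow> reg s' x = i \<Longrightarrow> I i s' \<Longrightarrow> same (For x e e' c) s s' \<Longrightarrow>
      runs c s' (T i) (\<lambda>s''. I (Suc i) (s''\<lparr>reg := (reg s'')(x := Suc i)\<rparr>))"
    and final: "\<And>s'. reg s' x = b \<Longrightarrow> I b s' \<Longrightarrow> same (For x e e' c) s s' \<Longrightarrow> Q s'"
    and time: "2 + (\<Sum>i=a..<b. T i + 2) \<le> U"
  shows "runs (For x e e' c) s U Q"
proof (rule runs_For_time[where a = a and b = b
      and I = "\<lambda>i \<tau> s'. I i s' \<and> \<tau> = (\<Sum>k=a..<i. T k + 2)"])
  fix i \<tau> s'
  assume i: "a \<le> i" "i < b" "reg s' x = i" "I i s' \<and> \<tau> = (\<Sum>k=a..<i. T k + 2)"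
    "same (For x e e' c) s s'"
  then have "runs c s' (T i) (\<lambda>s''. I (Suc i) (s''\<lparr>reg := (reg s'')(x := Suc i)\<rparr>))"
    by (intro step) auto
  then show "\<exists>K. runs c s' K (\<lambda>s''. I (Suc i) (s''\<lparr>reg := (reg s'')(x := Suc i)\<rparr>) \<and>
      \<tau> + K + 2 = (\<Sum>k=a..<Suc i. T k + 2))"
    using i by (intro exI[of _ "T i"]) simp
qed (use assms in auto)

section \<open>Sets listed in array segments\<close>

text \<open>Injectivity makes the length of the segment equal to the cardinality of
  \<open>S\<close>, so that loops over segments are charged in terms of sets.\<close>

definition slice :: "(nat \<Rightarrow> nat) \<Rightarrow> nat \<Rightarrow> nat \<Rightarrow> nat set \<Rightarrow> bool" where
  "slice A l h S \<longleftrightarrow> l \<le> h \<and> inj_on A {l..<h} \<and> A ` {l..<h} = S"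

lemma slice_card: "slice A l h S \<Longrightarrow> h - l = card S"
  unfolding slice_def by (metis card_atLeastLessThan card_image)

lemma slice_le: "slice A l h S \<Longrightarrow> l \<le> h"
  by (simp add: slice_def)

lemma slice_mem: "slice A l h S \<Longrightarrow> l \<le> j \<Longrightarrow> j < h \<Longrightarrow> A j \<in> S"
  by (auto simp: slice_def)

lemma slice_end: "slice A l h S \<Longrightarrow> A ` {l..<h} = S"
  by (simp add: slice_def)

lemma slice_fresh: "slice A l h S \<Longrightarrow> l \<le> j \<Longrightarrow> j < h \<Longrightarrow> A j \<notin> A ` {l..<j}"
  by (auto simp: slice_def dest: inj_onD)

lemma image_Suc_upt: "(l::nat) \<le> j \<Longrightarrow> A ` {l..<Suc j} = insert (A j) (A ` {l..<j})"
  by (simp add: atLeastLessThanSuc)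

lemma slice_empty [simp]: "slice A l l S \<longleftrightarrow> S = {}"
  by (auto simp: slice_def)

lemma slice_snoc:
  assumes "slice A l h S" "x \<notin> S"
  shows "slice (A(h := x)) l (Suc h) (insert x S)"
proof -
  have "(A(h := x)) ` {l..<h} = S"
    using assms by (force simp: slice_def)
  moreover have "inj_on (A(h := x)) {l..<h}"
    using assms by (auto simp: slice_def inj_on_def)
  ultimately show ?thesis
    using assms by (auto simp: slice_def atLeastLessThanSuc)
qed

lemma slice_cong: "slice A l h S \<Longrightarrow> (\<And>j. l \<le> j \<Longrightarrow> j < h \<Longrightarrow> B j = A j) \<Longrightarrow> slice B l h S"
  unfolding slice_def
  using inj_on_cong[of "{l..<h}" B A] image_cong[of "{l..<h}" "{l..<h}" B A] by auto

section \<open>Breadth-first search\<close>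

text \<open>
  Registers: 0 number of vertices, 1 root, 2 and 3 loop counters, 4 end of the queue, 5 end of the
  label array, 6 and 7 the two closer neighbours, 8 current vertex, 9 best candidate, 10 flag.
  Arrays: 4 distance plus one (0 if not visited), 5 queue, 6 and 7 start and end of the label of
  a vertex within array 8, 9 time stamps of the elements of the current label, 10 counters.
\<close>

text \<open>Otherwise the simplifier rewrites register and array number 1 to \<open>Suc 0\<close>.\<close>

declare One_nat_def [simp del]

definition each_nbr :: "com \<Rightarrow> com" where
  "each_nbr c = For 3 (Get 0 (Reg 8)) (Get 0 (Succ (Reg 8))) c"

definition min_degree :: com where
  "min_degree = Seq (Assign 1 (Const 0)) (For 2 (Const 0) (Reg 0)
     (Ite (Less (Sub (Get 0 (Succ (Reg 2))) (Get 0 (Reg 2)))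
                (Sub (Get 0 (Succ (Reg 1))) (Get 0 (Reg 1))))
       (Assign 1 (Reg 2)) Skip))"

text \<open>Both searches share their arrays, so distances and time stamps are cleared before
  each.\<close>

definition reset :: com where
  "reset = For 2 (Const 0) (Reg 0) (Seq (Put 4 (Reg 2) (Const 0)) (Put 9 (Reg 2) (Const 0)))"

definition visit :: com where
  "visit = Ite (Equal (Get 4 (Get 1 (Reg 3))) (Const 0))
     (Seq (Put 5 (Reg 4) (Get 1 (Reg 3)))
       (Seq (Assign 4 (Succ (Reg 4)))
         (Put 4 (Get 1 (Reg 3)) (Succ (Get 4 (Reg 8))))))
     Skip"

text \<open>A fixed number of rounds suffices without a test for an empty queue: the graph is
  connected, so the queue cannot run dry before every vertex has been processed.\<close>

definition search :: com where
  "search = For 2 (Const 0) (Reg 0) (Seq (Assign 8 (Get 5 (Reg 2))) (each_nbr visit))"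

definition bfs :: com where
  "bfs = Seq reset (Seq (Put 5 (Const 0) (Reg 1)) (Seq (Put 4 (Reg 1) (Const 1))
     (Seq (Assign 4 (Const 1)) search)))"

context down_closed
begin

section \<open>The stored graph and loops over neighbours\<close>

definition total :: nat where
  "total = (\<Sum>v<n. card (nbrs v))"

definition input :: "state \<Rightarrow> bool" where
  "input s \<longleftrightarrow> reg s 0 = n \<and> (\<forall>v<n. slice (arr s 1) (arr s 0 v) (arr s 0 (Suc v)) (nbrs v))"

lemma input_n: "input s \<Longrightarrow> reg s 0 = n"
  and input_nbrs: "input s \<Longrightarrow> v < n \<Longrightarrow> slice (arr s 1) (arr s 0 v) (arr s 0 (Suc v)) (nbrs v)"
  by (auto simp: input_def)

lemma input_same: "input s \<Longrightarrow> same c s s' \<Longrightarrow> 0 \<notin> rmods c \<Longrightarrow> {0, 1} \<inter> amods c = {} \<Longrightarrow> input s'"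
  by (simp add: input_def same_reg same_arr)

lemma degree: "input s \<Longrightarrow> v < n \<Longrightarrow> arr s 0 (Suc v) - arr s 0 v = card (nbrs v)"
  using input_nbrs slice_card by blast

text \<open>Hides the array layout: the invariant speaks about the set \<open>S\<close> of
  neighbours handled so far instead of the loop index. The quantified \<open>k\<close> absorbs the
  increment of register 3.\<close>

lemma runs_each_nbr:
  assumes s: "input s" "reg s 8 = v" "v < n"
    and fresh: "rmods c \<inter> {3, 8} = {}" "amods c \<inter> {0, 1} = {}"
    and init: "I {} (s\<lparr>reg := (reg s)(3 := arr s 0 v)\<rparr>)"
    and step: "\<And>S s'. arr s' 1 (reg s' 3) \<in> nbrs v - S \<Longrightarrow> I S s' \<Longrightarrow> same (each_nbr c) s s' \<Longrightarrow>
      runs c s' K (\<lambda>s''. \<forall>k. I (insert (arr s' 1 (reg s' 3)) S) (s''\<lparr>reg := (reg s'')(3 := k)\<rparr>))"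
    and final: "\<And>s'. I (nbrs v) s' \<Longrightarrow> same (each_nbr c) s s' \<Longrightarrow> Q s'"
    and time: "2 + card (nbrs v) * (K + 2) \<le> U"
  shows "runs (each_nbr c) s U Q"
proof -
  let ?A = "arr s 1" and ?l = "arr s 0 v" and ?h = "arr s 0 (Suc v)"
  have sl: "slice ?A ?l ?h (nbrs v)"
    using input_nbrs s by blast
  let ?J = "\<lambda>j s'. I (?A ` {?l..<j}) s'"
  show ?thesis
    unfolding each_nbr_def
  proof (rule runs_For[where a = ?l and b = ?h and I = ?J and T = "\<lambda>_. K"])
    show "3 \<notin> rmods c" using fresh by auto
    show "aval (Get 0 (Reg 8)) s = ?l" using s by simp
    show "?l \<le> ?h" using slice_le[OF sl] .
    show "?J ?l (s\<lparr>reg := (reg s)(3 := ?l)\<rparr>)" using init by simp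
    show "2 + (\<Sum>i=?l..<?h. K + 2) \<le> U"
      using time slice_card[OF sl] by (simp add: algebra_simps)
    fix s'
    assume same: "same (For 3 (Get 0 (Reg 8)) (Get 0 (Succ (Reg 8))) c) s s'"
    have same': "arr s' 0 = arr s 0" "arr s' 1 = arr s 1" "reg s' 8 = reg s 8"
      using same_arr[OF same] same_reg[OF same] fresh by auto
    then show "aval (Get 0 (Succ (Reg 8))) s' = ?h"
      using s by simp
    show "Q s'" if "?J ?h s'"
      using final[of s'] that same slice_end[OF sl] by (simp add: each_nbr_def)
    fix i
    assume i: "?l \<le> i" "i < ?h" "reg s' 3 = i" "?J i s'"
    then have "arr s' 1 (reg s' 3) \<in> nbrs v - ?A ` {?l..<i}"
      using slice_mem[OF sl i(1,2)] slice_fresh[OF sl i(1,2)] same' by simp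
    then have "runs c s' K (\<lambda>s''. \<forall>k. I (insert (?A i) (?A ` {?l..<i})) (s''\<lparr>reg := (reg s'')(3 := k)\<rparr>))"
      using step[OF _ i(4)] same by (simp add: each_nbr_def i(3) same'(2))
    then show "runs c s' K (\<lambda>s''. ?J (Suc i) (s''\<lparr>reg := (reg s'')(3 := Suc i)\<rparr>))"
      by (rule runs_mono) (simp_all add: image_Suc_upt[OF i(1)])
  qed
qed

lemma runs_min_degree:
  assumes s: "input s"
  shows "runs min_degree s (3 + 4 * n)
    (\<lambda>s'. reg s' 1 < n \<and> (\<forall>v<n. card (nbrs (reg s' 1)) \<le> card (nbrs v)))"
proof -
  let ?s = "s\<lparr>reg := (reg s)(1 := 0)\<rparr>"
  let ?I = "\<lambda>i s'. reg s' 1 < n \<and> (\<forall>v<i. card (nbrs (reg s' 1)) \<le> card (nbrs v))"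
  let ?c = "Ite (Less (Sub (Get 0 (Succ (Reg 2))) (Get 0 (Reg 2)))
                (Sub (Get 0 (Succ (Reg 1))) (Get 0 (Reg 1))))
       (Assign 1 (Reg 2)) Skip"
  have "runs (For 2 (Const 0) (Reg 0) ?c) ?s (2 + 4 * n) (?I n)"
  proof (rule runs_For[where a = 0 and b = n and I = ?I and T = "\<lambda>_. 2"])
    fix s'
    assume same: "same (For 2 (Const 0) (Reg 0) ?c) ?s s'"
    have s': "reg s' 0 = n" "arr s' 0 = arr s 0"
      using same_reg[OF same] same_arr[OF same] input_n[OF s] by auto
    then show "aval (Reg 0) s' = n" by simp
    fix i
    assume i: "i < n" "reg s' 2 = i" "?I i s'"
    then have "card (nbrs i) = arr s 0 (Suc i) - arr s 0 i"
      "card (nbrs (reg s' 1)) = arr s 0 (Suc (reg s' 1)) - arr s 0 (reg s' 1)"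
      using degree[OF s] by auto
    then show "runs ?c s' 2 (\<lambda>s''. ?I (Suc i) (s''\<lparr>reg := (reg s'')(2 := Suc i)\<rparr>))"
      using i s' by (auto simp: less_Suc_eq)
  qed (use n_pos in auto)
  then show ?thesis
    by (simp add: min_degree_def)
qed

section \<open>Invariants of breadth-first search\<close>

text \<open>Position \<open>i\<close> of the queue \<open>q\<close>, which ends at \<open>m\<close>,
  is being processed, and the neighbours in \<open>S\<close> have been scanned. Distances along the
  queue are sorted and exceed that of the current vertex by at most one.\<close>

definition bfs_inv :: "nat \<Rightarrow> nat \<Rightarrow> nat set \<Rightarrow> (nat \<Rightarrow> nat) \<Rightarrow> nat \<Rightarrow> (nat \<Rightarrow> nat) \<Rightarrow> bool" where
  "bfs_inv r i S q m d \<longleftrightarrow> i < m \<and> inj_on q {..<m} \<and> q ` {..<m} \<subseteq> {..<n} \<and> r \<in> q ` {..<m} \<and>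
     (\<forall>k l. k \<le> l \<longrightarrow> l < m \<longrightarrow> dd r (q k) \<le> dd r (q l)) \<and>
     (\<forall>k<m. dd r (q k) \<le> Suc (dd r (q i))) \<and>
     (\<forall>k<i. nbrs (q k) \<subseteq> q ` {..<m}) \<and> S \<subseteq> q ` {..<m} \<and>
     (\<forall>v<n. d v = (if v \<in> q ` {..<m} then Suc (dd r v) else 0))"

definition bfs_ok :: "nat \<Rightarrow> (nat \<Rightarrow> nat) \<Rightarrow> (nat \<Rightarrow> nat) \<Rightarrow> bool" where
  "bfs_ok r q d \<longleftrightarrow> bij_betw q {..<n} {..<n} \<and>
     (\<forall>k l. k \<le> l \<longrightarrow> l < n \<longrightarrow> dd r (q k) \<le> dd r (q l)) \<and> (\<forall>v<n. d v = Suc (dd r v))"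

lemma bfs_inv_init:
  "r < n \<Longrightarrow> q 0 = r \<Longrightarrow> (\<And>v. v < n \<Longrightarrow> d v = (if v = r then 1 else 0)) \<Longrightarrow> bfs_inv r 0 {} q 1 d"
  by (auto simp: bfs_inv_def One_nat_def lessThan_Suc)

text \<open>By induction on the distance, a neighbour of \<open>y\<close> closer to the root is
  already queued. Being closer than \<open>q i\<close>, it stands before position \<open>i\<close>,
  so all its neighbours, among them \<open>y\<close>, are queued.\<close>

lemma bfs_inv_closer:
  assumes inv: "bfs_inv r i S q m d" and r: "r < n" and y: "y < n" "dd r y < dd r (q i)"
  shows "y \<in> q ` {..<m}"
  using y
proof (induction "dd r y" arbitrary: y rule: less_induct)
  case less
  show ?case
  proof (cases "y = r")
    case True
    then show ?thesis using inv by (simp add: bfs_inv_def)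
  next
    case False
    then obtain p where p: "p \<in> down_nbrs r y"
      using down_nbr_exists[OF r less.prems(1)] by blast
    then have p': "p < n" "dd r p < dd r y" "p \<in> nbrs y"
      using down_nbrs_less[OF p] by (auto simp: down_nbrs_def)
    then have "p \<in> q ` {..<m}"
      using less by simp
    then obtain k where k: "k < m" "p = q k" by blast
    have "\<not> i \<le> k"
    proof
      assume "i \<le> k"
      then have "dd r (q i) \<le> dd r (q k)"
        using inv k by (simp add: bfs_inv_def)
      then show False using k p' less.prems by simp
    qed
    then have "nbrs p \<subseteq> q ` {..<m}"
      using inv k by (simp add: bfs_inv_def)
    then show ?thesis
      using nbrs_sym[OF less.prems(1) p'(3)] by blast
  qed
qed

lemma bfs_inv_visit:
  assumes inv: "bfs_inv r i S q m d" and r: "r < n" and x: "x \<in> nbrs (q i)"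
  shows "d x \<noteq> 0 \<Longrightarrow> bfs_inv r i (insert x S) q m d"
    and "d x = 0 \<Longrightarrow> bfs_inv r i (insert x S) (q(m := x)) (Suc m) (d(x := Suc (d (q i))))"
proof -
  have xn: "x < n" using nbrs_less x by blast
  have d: "d v = (if v \<in> q ` {..<m} then Suc (dd r v) else 0)" if "v < n" for v
    using inv that by (simp add: bfs_inv_def)
  show "bfs_inv r i (insert x S) q m d" if "d x \<noteq> 0"
    using inv d[OF xn] that by (simp add: bfs_inv_def split: if_splits)
  assume "d x = 0"
  then have new: "x \<notin> q ` {..<m}"
    using d[OF xn] by (simp split: if_splits)
  have im: "i < m" using inv by (simp add: bfs_inv_def)
  then have qi: "q i < n" "d (q i) = Suc (dd r (q i))"
    using inv d[of "q i"] by (auto simp: bfs_inv_def)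
  \<comment> \<open>The alternative, \<open>x\<close> being closer than \<open>q i\<close>, would
    mean that \<open>x\<close> is queued already.\<close>
  have "dd r x = Suc (dd r (q i))"
    using dd_nbrs[OF r qi(1) x] bfs_inv_closer[OF inv r xn] new by auto
  let ?q = "q(m := x)"
  have img: "?q ` {..<Suc m} = insert x (q ` {..<m})"
    by (auto simp: lessThan_Suc)
  have q: "?q k = q k" if "k < m" for k
    using that by simp
  show "bfs_inv r i (insert x S) ?q (Suc m) (d(x := Suc (d (q i))))"
    unfolding bfs_inv_def img
  proof (intro conjI)
    show "inj_on ?q {..<Suc m}"
      using inv new by (auto simp: bfs_inv_def lessThan_Suc inj_on_def)
    show "\<forall>k l. k \<le> l \<longrightarrow> l < Suc m \<longrightarrow> dd r (?q k) \<le> dd r (?q l)"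
      using inv \<open>dd r x = _\<close> by (auto simp: bfs_inv_def less_Suc_eq)
    show "\<forall>v<n. (d(x := Suc (d (q i)))) v = (if v \<in> insert x (q ` {..<m}) then Suc (dd r v) else 0)"
      using d qi \<open>dd r x = _\<close> by auto
    show "\<forall>k<Suc m. dd r (?q k) \<le> Suc (dd r (?q i))"
      using inv \<open>dd r x = _\<close> im by (auto simp: bfs_inv_def less_Suc_eq)
    show "\<forall>k<i. nbrs (?q k) \<subseteq> insert x (q ` {..<m})"
      using inv im by (auto simp: bfs_inv_def)
  qed (use inv xn im in \<open>auto simp: bfs_inv_def\<close>)
qed

lemma bfs_inv_next:
  assumes inv: "bfs_inv r i (nbrs (q i)) q m d" and r: "r < n"
  shows "Suc i < n \<Longrightarrow> bfs_inv r (Suc i) {} q m d"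
    and "Suc i = n \<Longrightarrow> bfs_ok r q d"
proof -
  have inj: "inj_on q {..<m}" and sub: "q ` {..<m} \<subseteq> {..<n}" and im: "i < m"
    using inv by (auto simp: bfs_inv_def)
  have closed: "\<forall>k<Suc i. nbrs (q k) \<subseteq> q ` {..<m}"
    using inv by (auto simp: bfs_inv_def less_Suc_eq)
  have "m \<le> n"
    using card_mono[OF _ sub] card_image[OF inj] by simp
  \<comment> \<open>If nothing is left in the queue after position \<open>i\<close>, the queued
    vertices are closed under neighbours, and connectedness puts every vertex among them.\<close>
  have *: "n \<le> m" if "m = Suc i"
  proof -
    have "y \<in> q ` {..<m}" if "y < n" for y
      using that
    proof (induction "dd r y" arbitrary: y rule: less_induct)
      case less
      show ?case
      proof (cases "y = r")
        case True
        then show ?thesis using inv by (simp add: bfs_inv_def)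
      next
        case False
        then obtain p where p: "p \<in> down_nbrs r y"
          using down_nbr_exists[OF r less.prems(1)] by blast
        then have p': "p < n" "dd r p < dd r y" "p \<in> nbrs y"
          using down_nbrs_less[OF p] by (auto simp: down_nbrs_def)
        then have "p \<in> q ` {..<m}"
          using less by simp
        then have "nbrs p \<subseteq> q ` {..<m}"
          using closed \<open>m = Suc i\<close> by auto
        then show ?thesis
          using nbrs_sym[OF less.prems(1) p'(3)] by blast
      qed
    qed
    then have "{..<n} \<subseteq> q ` {..<m}" by auto
    then have "card {..<n} \<le> card (q ` {..<m})"
      by (rule card_mono[rotated]) simp
    then show ?thesis
      using card_image[OF inj] by simp
  qed
  show "bfs_inv r (Suc i) {} q m d" if "Suc i < n"
  proof -
    have "Suc i < m"
      using * im that by linarith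
    then have "dd r (q i) \<le> dd r (q (Suc i))"
      using inv by (simp add: bfs_inv_def)
    moreover have "\<forall>k<m. dd r (q k) \<le> Suc (dd r (q i))"
      using inv by (simp add: bfs_inv_def)
    ultimately have "\<forall>k<m. dd r (q k) \<le> Suc (dd r (q (Suc i)))"
      by (meson Suc_le_mono le_trans)
    then show ?thesis
      using inv closed \<open>Suc i < m\<close> unfolding bfs_inv_def by simp
  qed
  show "bfs_ok r q d" if "Suc i = n"
  proof -
    have "m = n"
      using im that \<open>m \<le> n\<close> by simp
    then have "q ` {..<n} = {..<n}"
      using card_image[OF inj] sub by (intro card_subset_eq) auto
    then show ?thesis
      using inv \<open>m = n\<close> by (simp add: bfs_inv_def bfs_ok_def bij_betw_def)
  qed
qed

lemma sum_queue:
  assumes "bij_betw q {..<n} {..<n}"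
  shows "(\<Sum>i<n. card (nbrs (q i))) = total"
  unfolding total_def using assms by (rule sum.reindex_bij_betw)

section \<open>Correctness and time of the search\<close>

text \<open>The unchanged queue entries matter for the time bound, as the time spent so far is
  expressed by the degrees of these entries.\<close>

lemma runs_visit_all:
  assumes s: "input s" "reg s 8 = arr s 5 i" "r < n"
    and inv: "bfs_inv r i {} (arr s 5) (reg s 4) (arr s 4)"
  shows "runs (each_nbr visit) s (2 + 6 * card (nbrs (arr s 5 i)))
    (\<lambda>s'. bfs_inv r i (nbrs (arr s' 5 i)) (arr s' 5) (reg s' 4) (arr s' 4) \<and>
       (\<forall>k\<le>i. arr s' 5 k = arr s 5 k))"
proof -
  let ?v = "arr s 5 i"
  have v: "?v < n"
    using inv by (auto simp: bfs_inv_def)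
  let ?I = "\<lambda>S s'. (\<forall>k\<le>i. arr s' 5 k = arr s 5 k) \<and> bfs_inv r i S (arr s' 5) (reg s' 4) (arr s' 4)"
  show ?thesis
  proof (rule runs_each_nbr[where I = ?I and K = 4])
    fix S and s' :: state
    let ?x = "arr s' 1 (reg s' 3)"
    assume x: "?x \<in> nbrs ?v - S" and I: "?I S s'" and same: "same (each_nbr visit) s s'"
    have "reg s' 8 = ?v"
      using same_reg[OF same, of 8] s by (simp add: each_nbr_def visit_def)
    moreover have "i < reg s' 4"
      using I by (simp add: bfs_inv_def)
    moreover note bfs_inv_visit[of r i S "arr s' 5" "reg s' 4" "arr s' 4" ?x] I x \<open>r < n\<close>
    ultimately show "runs visit s' 4
        (\<lambda>s''. \<forall>k. ?I (insert ?x S) (s''\<lparr>reg := (reg s'')(3 := k)\<rparr>))"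
      by (simp add: visit_def)
  qed (use s v inv in \<open>auto simp: visit_def\<close>)
qed

lemma runs_search:
  assumes s: "input s" "r < n" and inv: "bfs_inv r 0 {} (arr s 5) (reg s 4) (arr s 4)"
  shows "runs search s (2 + 5 * n + 6 * total) (\<lambda>s'. bfs_ok r (arr s' 5) (arr s' 4))"
proof -
  let ?c = "Seq (Assign 8 (Get 5 (Reg 2))) (each_nbr visit)"
  let ?I = "\<lambda>i s'. (if i < n then bfs_inv r i {} (arr s' 5) (reg s' 4) (arr s' 4)
    else bfs_ok r (arr s' 5) (arr s' 4))"
  show ?thesis
    unfolding search_def
  \<comment> \<open>The cost of round \<open>i\<close> depends on the vertex that the queue holds
    there, which is unknown beforehand; hence the time parameter is a function of the current
    queue.\<close>
  proof (rule runs_For_time[where a = 0 and b = n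
        and I = "\<lambda>i \<tau> s'. ?I i s' \<and> \<tau> = 5 * i + 6 * (\<Sum>k<i. card (nbrs (arr s' 5 k)))"])
    show "2 \<notin> rmods ?c"
      by (simp add: each_nbr_def visit_def)
    fix s'
    assume same: "same (For 2 (Const 0) (Reg 0) ?c) s s'"
    then have s': "input s'"
      using input_same[OF s(1)] by (simp add: each_nbr_def visit_def)
    then show "aval (Reg 0) s' = n"
      by (simp add: input_n)
    \<comment> \<open>The final queue is a permutation of the vertices, so the degrees along it sum
      to \<open>total\<close>.\<close>
    show "bfs_ok r (arr s' 5) (arr s' 4) \<and> \<tau> + 2 \<le> 2 + 5 * n + 6 * total"
      if "?I n s' \<and> \<tau> = 5 * n + 6 * (\<Sum>k<n. card (nbrs (arr s' 5 k)))" for \<tau>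
      using that sum_queue[of "arr s' 5"] by (simp add: bfs_ok_def)
    fix i \<tau>
    assume i: "i < n" "reg s' 2 = i"
      and I: "?I i s' \<and> \<tau> = 5 * i + 6 * (\<Sum>k<i. card (nbrs (arr s' 5 k)))"
    let ?v = "arr s' 5 i"
    let ?s = "s'\<lparr>reg := (reg s')(8 := ?v)\<rparr>"
    have "input ?s" using s' by (simp add: input_def)
    then have "runs (each_nbr visit) ?s (2 + 6 * card (nbrs ?v))
      (\<lambda>s''. bfs_inv r i (nbrs (arr s'' 5 i)) (arr s'' 5) (reg s'' 4) (arr s'' 4) \<and>
        (\<forall>k\<le>i. arr s'' 5 k = arr s' 5 k))"
      using runs_visit_all[of ?s i r] I i s by simp
    then have "runs ?c s' (3 + 6 * card (nbrs ?v))
      (\<lambda>s''. bfs_inv r i (nbrs (arr s'' 5 i)) (arr s'' 5) (reg s'' 4) (arr s'' 4) \<and>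
        (\<forall>k\<le>i. arr s'' 5 k = arr s' 5 k))"
      using i by simp
    moreover have "?I (Suc i) (s''\<lparr>reg := (reg s'')(2 := Suc i)\<rparr>) \<and>
        \<tau> + (3 + 6 * card (nbrs ?v)) + 2 = 5 * Suc i + 6 * (\<Sum>k<Suc i. card (nbrs (arr s'' 5 k)))"
      if "bfs_inv r i (nbrs (arr s'' 5 i)) (arr s'' 5) (reg s'' 4) (arr s'' 4) \<and>
        (\<forall>k\<le>i. arr s'' 5 k = arr s' 5 k)" for s''
    proof -
      have "(\<Sum>k<i. card (nbrs (arr s'' 5 k))) = (\<Sum>k<i. card (nbrs (arr s' 5 k)))"
        using that by (intro sum.cong) auto
      moreover have "Suc i = n" if "\<not> Suc i < n"
        using that i by simp
      ultimately show ?thesis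
        using bfs_inv_next[of r i "arr s'' 5" "reg s'' 4" "arr s'' 4"] that I \<open>r < n\<close> by auto
    qed
    ultimately show "\<exists>K. runs ?c s' K (\<lambda>s''. ?I (Suc i) (s''\<lparr>reg := (reg s'')(2 := Suc i)\<rparr>) \<and>
        \<tau> + K + 2 = 5 * Suc i + 6 * (\<Sum>k<Suc i. card (nbrs (arr (s''\<lparr>reg := (reg s'')(2 := Suc i)\<rparr>) 5 k))))"
      by (intro exI[of _ "3 + 6 * card (nbrs ?v)"]) (auto elim!: runs_mono)
  qed (use inv n_pos in auto)
qed

lemma runs_reset:
  assumes "input s"
  shows "runs reset s (2 + 4 * n) (\<lambda>s'. \<forall>v<n. arr s' 4 v = 0 \<and> arr s' 9 v = 0)"
  unfolding reset_def
proof (rule runs_For[where a = 0 and b = n and T = "\<lambda>_. 2"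
      and I = "\<lambda>i s'. \<forall>v<i. arr s' 4 v = 0 \<and> arr s' 9 v = 0"])
  fix s'
  assume "same (For 2 (Const 0) (Reg 0) (Seq (Put 4 (Reg 2) (Const 0)) (Put 9 (Reg 2) (Const 0)))) s s'"
  then show "aval (Reg 0) s' = n"
    using input_n[OF assms] by (simp add: same_reg)
qed (auto simp: less_Suc_eq)

lemma runs_bfs:
  assumes s: "input s" "reg s 1 = r" "r < n"
  shows "runs bfs s (7 + 9 * n + 6 * total)
    (\<lambda>s'. bfs_ok r (arr s' 5) (arr s' 4) \<and> (\<forall>v<n. arr s' 9 v = 0))"
  unfolding bfs_def
proof (rule runs_SeqI_same[OF runs_reset[OF s(1)], where T' = "5 + 5 * n + 6 * total"])
  fix s1
  assume s1: "\<forall>v<n. arr s1 4 v = 0 \<and> arr s1 9 v = 0" and same: "same reset s s1"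
  let ?s = "s1\<lparr>arr := (arr s1)(5 := (arr s1 5)(0 := r), 4 := (arr s1 4)(r := 1)),
    reg := (reg s1)(4 := 1)\<rparr>"
  have r: "reg s1 1 = r"
    using same_reg[OF same] s by (simp add: reset_def)
  have "input ?s"
    using input_same[OF s(1) same] by (simp add: reset_def input_def)
  then have "runs search ?s (2 + 5 * n + 6 * total)
      (\<lambda>s'. bfs_ok r (arr s' 5) (arr s' 4) \<and> same search ?s s')"
    by (intro runs_same runs_search) (use s s1 in \<open>auto intro!: bfs_inv_init\<close>)
  then have "runs search ?s (2 + 5 * n + 6 * total)
      (\<lambda>s'. bfs_ok r (arr s' 5) (arr s' 4) \<and> (\<forall>v<n. arr s' 9 v = 0))"
    by (rule runs_mono) (use s1 in \<open>auto simp: same_def search_def each_nbr_def visit_def\<close>)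
  then show "runs (Seq (Put 5 (Const 0) (Reg 1)) (Seq (Put 4 (Reg 1) (Const 1))
      (Seq (Assign 4 (Const 1)) search))) s1 (5 + 5 * n + 6 * total)
      (\<lambda>s'. bfs_ok r (arr s' 5) (arr s' 4) \<and> (\<forall>v<n. arr s' 9 v = 0))"
    by (simp add: r)
qed simp

end

section \<open>Labels\<close>

text \<open>Register 6 equal to the number of vertices means that nothing has been found. The first
  find goes into both registers, later ones only into register 7.\<close>

definition find_down :: com where
  "find_down = Ite (Equal (Succ (Get 4 (Get 1 (Reg 3)))) (Get 4 (Reg 8)))
     (Ite (Equal (Reg 6) (Reg 0))
       (Seq (Assign 6 (Get 1 (Reg 3))) (Assign 7 (Get 1 (Reg 3))))
       (Assign 7 (Get 1 (Reg 3))))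
     Skip"

definition copy_new :: com where
  "copy_new = Ite (Equal (Get 9 (Get 8 (Reg 3))) (Succ (Reg 2))) Skip
     (Seq (Put 9 (Get 8 (Reg 3)) (Succ (Reg 2)))
       (Seq (Put 8 (Reg 5) (Get 8 (Reg 3))) (Assign 5 (Succ (Reg 5)))))"

definition copy_label :: "nat \<Rightarrow> com" where
  "copy_label x = For 3 (Get 6 (Reg x)) (Get 7 (Reg x)) copy_new"

text \<open>Array 4 holds distances plus one, so the two tests separate distance at least two, one
  and zero.\<close>

definition write_label :: com where
  "write_label = Ite (Less (Const 2) (Get 4 (Reg 8)))
     (Seq (Assign 6 (Reg 0)) (Seq (each_nbr find_down) (Seq (copy_label 6) (copy_label 7))))
     (Ite (Less (Const 1) (Get 4 (Reg 8)))
       (Seq (Put 8 (Reg 5) (Reg 8)) (Assign 5 (Succ (Reg 5)))) Skip)"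

definition label_step :: com where
  "label_step = Seq (Assign 8 (Get 5 (Reg 2))) (Seq (Put 6 (Reg 8) (Reg 5))
     (Seq write_label (Put 7 (Reg 8) (Reg 5))))"

definition labels :: com where
  "labels = Seq (Assign 5 (Const 0)) (For 2 (Const 0) (Reg 0) label_step)"

context down_closed
begin

section \<open>Correctness and time of the labelling\<close>

text \<open>Here \<open>K\<close> contains the closer neighbours seen so far. The last clause is the
  side condition of \<open>label_good\<close>.\<close>

definition found :: "nat set \<Rightarrow> nat \<Rightarrow> nat \<Rightarrow> bool" where
  "found K p q \<longleftrightarrow> (K = {} \<longrightarrow> p = n) \<and>
     (K \<noteq> {} \<longrightarrow> p \<in> K \<and> q \<in> K \<and> (p = q \<longrightarrow> K = {p}))"

lemma found_insert:
  assumes "found K p q" "K \<subseteq> {..<n}" "x \<notin> K"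
  shows "p = n \<Longrightarrow> found (insert x K) x x" and "p \<noteq> n \<Longrightarrow> found (insert x K) p x"
  using assms by (auto simp: found_def)

lemma runs_find_down:
  assumes s: "input s" "reg s 8 = v" "v < n" "reg s 6 = n"
    and d: "\<forall>x<n. arr s 4 x = Suc (dd r x)"
  shows "runs (each_nbr find_down) s (2 + 6 * card (nbrs v))
    (\<lambda>s'. found (down_nbrs r v) (reg s' 6) (reg s' 7))"
proof -
  let ?D = "down_nbrs r v"
  let ?I = "\<lambda>S s'. found (S \<inter> ?D) (reg s' 6) (reg s' 7)"
  show ?thesis
  proof (rule runs_each_nbr[where I = ?I and K = 4])
    fix S and s' :: state
    let ?x = "arr s' 1 (reg s' 3)"
    assume x: "?x \<in> nbrs v - S" and I: "?I S s'" and same: "same (each_nbr find_down) s s'"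
    have s': "reg s' 8 = v" "reg s' 0 = n" "arr s' 4 = arr s 4"
      using same_reg[OF same] same_arr[OF same] s input_n[OF s(1)]
      by (auto simp: each_nbr_def find_down_def)
    have xn: "?x < n" using x nbrs_less by blast
    have down: "Suc (arr s 4 ?x) = arr s 4 v \<longleftrightarrow> ?x \<in> down_nbrs r v"
      using d s' s(3) xn x by (simp add: down_nbrs_def)
    have "S \<inter> ?D \<subseteq> {..<n}"
      using down_nbrs_less by blast
    note new = found_insert[OF I this, of ?x]
    have "?I (insert ?x S) (s'\<lparr>reg := (reg s')(6 := ?x, 7 := ?x)\<rparr>)"
      if "?x \<in> ?D" "reg s' 6 = n"
      using that new x by simp
    moreover have "?I (insert ?x S) (s'\<lparr>reg := (reg s')(7 := ?x)\<rparr>)"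
      if "?x \<in> ?D" "reg s' 6 \<noteq> n"
      using that new x by simp
    moreover have "?I (insert ?x S) s'" if "?x \<notin> ?D"
      using that I by simp
    ultimately show "runs find_down s' 4
        (\<lambda>s''. \<forall>k. ?I (insert ?x S) (s''\<lparr>reg := (reg s'')(3 := k)\<rparr>))"
      by (cases "?x \<in> ?D") (auto simp add: find_down_def s' down)
  next
    show "?I {} (s\<lparr>reg := (reg s)(3 := arr s 0 v)\<rparr>)"
      using s by (simp add: found_def)
    fix s'
    assume "?I (nbrs v) s'"
    moreover have "nbrs v \<inter> ?D = ?D"
      by (auto simp: down_nbrs_def)
    ultimately show "found ?D (reg s' 6) (reg s' 7)"
      by simp
  qed (use s in \<open>auto simp: find_down_def\<close>)
qed

text \<open>The new label grows from \<open>l\<close> to \<open>h\<close>, the stamps record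
  membership in it, and everything below \<open>l\<close>, where the earlier labels lie, is still as
  in \<open>A\<close>.\<close>

definition copied :: "(nat \<Rightarrow> nat) \<Rightarrow> nat \<Rightarrow> nat \<Rightarrow> nat set \<Rightarrow> (nat \<Rightarrow> nat) \<Rightarrow> nat \<Rightarrow> (nat \<Rightarrow> nat) \<Rightarrow> bool" where
  "copied A l i S B h mark \<longleftrightarrow> slice B l h S \<and>
     (\<forall>y<n. mark y \<le> Suc i \<and> (mark y = Suc i \<longleftrightarrow> y \<in> S)) \<and> (\<forall>j<l. B j = A j)"

lemma copied_insert:
  assumes "copied A l i S B h mark" "y \<notin> S"
  shows "copied A l i (insert y S) (B(h := y)) (Suc h) (mark(y := Suc i))"
proof -
  have "l \<le> h" "slice (B(h := y)) l (Suc h) (insert y S)"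
    using assms slice_le by (auto simp: copied_def intro: slice_snoc)
  then show ?thesis
    using assms by (auto simp: copied_def)
qed

text \<open>The source ends at or before \<open>l\<close> and writing starts at or after
  \<open>l\<close>, so copying never overwrites what is still to be read. The stamps skip elements
  that are already in \<open>S\<close>.\<close>

lemma runs_copy_label:
  assumes x: "x \<notin> {3, 5}" and p: "slice (arr s 8) (arr s 6 (reg s x)) (arr s 7 (reg s x)) X"
    and X: "X \<subseteq> {..<n}" and l: "arr s 7 (reg s x) \<le> l" and i: "reg s 2 = i"
    and A: "\<forall>j<l. arr s 8 j = A j" and S: "copied A l i S (arr s 8) (reg s 5) (arr s 9)"
  shows "runs (copy_label x) s (2 + 6 * card X)
    (\<lambda>s'. copied A l i (S \<union> X) (arr s' 8) (reg s' 5) (arr s' 9))"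
proof -
  let ?a = "arr s 6 (reg s x)" and ?b = "arr s 7 (reg s x)"
  define L where "L = arr s 8"
  have p: "slice L ?a ?b X" and A: "\<forall>j<l. L j = A j"
    using p A by (simp_all add: L_def)
  let ?J = "\<lambda>j s'. copied A l i (S \<union> L ` {?a..<j}) (arr s' 8) (reg s' 5) (arr s' 9)"
  show ?thesis
    unfolding copy_label_def
  proof (rule runs_For[where a = ?a and b = ?b and I = ?J and T = "\<lambda>_. 4"])
    fix s'
    assume same: "same (For 3 (Get 6 (Reg x)) (Get 7 (Reg x)) copy_new) s s'"
    have s': "reg s' 2 = i" "reg s' x = reg s x" "arr s' 7 = arr s 7"
      using same_reg[OF same] same_arr[OF same] x i by (auto simp: copy_new_def)
    then show "aval (Get 7 (Reg x)) s' = ?b" by simp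
    show "copied A l i (S \<union> X) (arr s' 8) (reg s' 5) (arr s' 9)" if "?J ?b s'"
      using that slice_end[OF p] by simp
    fix j
    assume j: "?a \<le> j" "j < ?b" "reg s' 3 = j" "?J j s'"
    let ?S = "S \<union> L ` {?a..<j}" and ?y = "arr s' 8 j"
    have "j < l" using j l by simp
    then have "L j = ?y"
      using j(4) A by (simp add: copied_def)
    then have y: "S \<union> L ` {?a..<Suc j} = insert ?y ?S" and yn: "?y < n"
      using image_Suc_upt[OF j(1), of L] slice_mem[OF p j(1,2)] X by auto
    have mark: "arr s' 9 ?y = Suc i \<longleftrightarrow> ?y \<in> ?S"
      using j(4) yn by (simp add: copied_def)
    show "runs copy_new s' 4 (\<lambda>s''. ?J (Suc j) (s''\<lparr>reg := (reg s'')(3 := Suc j)\<rparr>))"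
    proof (cases "?y \<in> ?S")
      case True
      then have "insert ?y ?S = ?S" by blast
      then show ?thesis
        using mark True j(3,4) unfolding y copy_new_def by (simp add: s')
    next
      case False
      then show ?thesis
        using mark copied_insert[OF j(4) False] j(3) unfolding y copy_new_def
        by (auto simp add: s')
    qed
  next
    show "2 + (\<Sum>j = ?a..<?b. 4 + 2) \<le> 2 + 6 * card X"
      using slice_card[OF p] by simp
  qed (use S slice_le[OF p] in \<open>auto simp: copy_new_def\<close>)
qed

definition stored :: "nat \<Rightarrow> nat set \<Rightarrow> state \<Rightarrow> bool" where
  "stored r X s \<longleftrightarrow> (\<forall>x\<in>X. slice (arr s 8) (arr s 6 x) (arr s 7 x) (label r x))"

lemma runs_write_label:
  assumes good: "good r" and s: "input s" "reg s 8 = v" "v < n" "reg s 2 = i" "reg s 5 = l"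
    and d: "\<forall>x<n. arr s 4 x = Suc (dd r x)" and st: "stored r (down_nbrs r v) s"
    and l: "\<forall>x \<in> down_nbrs r v. arr s 7 x \<le> l" and mark: "\<forall>x<n. arr s 9 x \<le> i"
  shows "runs write_label s (8 + 18 * card (nbrs v))
    (\<lambda>s'. slice (arr s' 8) l (reg s' 5) (label r v) \<and> (\<forall>j<l. arr s' 8 j = arr s 8 j) \<and>
       (\<forall>x<n. arr s' 9 x \<le> Suc i))"
proof -
  have r: "r < n" using good by (simp add: good_def)
  consider "dd r v = 0" | "dd r v = 1" | "2 \<le> dd r v" by linarith
  then show ?thesis
  proof cases
    case 1
    then have "v = r" using dd_eq_0_iff r s by blast
    then show ?thesis
      using d s mark 1 label_self[OF r] by (auto simp: write_label_def le_SucI)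
  next
    case 2
    then have "v \<in> nbrs r" using s by (simp add: nbrs_def)
    then have "label r v = {v}" by (rule label_nbr[OF r])
    moreover have "slice ((arr s 8)(l := v)) l (Suc l) {v}"
      using slice_snoc[of "arr s 8" l l "{}" v] by simp
    ultimately show ?thesis
      using d s mark 2 by (auto simp: write_label_def le_SucI)
  next
    case 3
    let ?s = "s\<lparr>reg := (reg s)(6 := n)\<rparr>"
    let ?P = "\<lambda>s'. reg s' 6 \<in> down_nbrs r v \<and> reg s' 7 \<in> down_nbrs r v \<and>
       (reg s' 6 = reg s' 7 \<longrightarrow> down_nbrs r v = {reg s' 6})"
    let ?k = "card (nbrs v)"
    let ?Q = "\<lambda>S s'. copied (arr s 8) l i S (arr s' 8) (reg s' 5) (arr s' 9)"
    have "v \<noteq> r" using 3 by auto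
    then have ne: "down_nbrs r v \<noteq> {}"
      using down_nbr_exists r s by blast
    have "runs (Seq (each_nbr find_down) (Seq (copy_label 6) (copy_label 7))) ?s (6 + 18 * ?k)
      (?Q (label r v))"
    proof (rule runs_SeqI_same[where P = ?P and T = "2 + 6 * ?k" and T' = "4 + 12 * ?k"])
      show "runs (each_nbr find_down) ?s (2 + 6 * ?k) ?P"
        by (rule runs_mono[OF runs_find_down[where v = v and r = r]])
          (use s d ne in \<open>auto simp: input_def found_def\<close>)
      fix s1
      assume P: "?P s1" and same: "same (each_nbr find_down) ?s s1"
      let ?p = "reg s1 6" and ?q = "reg s1 7"
      have p: "?p \<in> down_nbrs r v" and q: "?q \<in> down_nbrs r v" using P by auto
      have s1: "reg s1 2 = i" "reg s1 5 = l" "arr s1 = arr s"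
        using same_reg[OF same] same_arr[OF same] s by (auto simp: each_nbr_def find_down_def)
      have un: "label r v = label r ?p \<union> label r ?q"
        using label_good[OF good s(3) 3 p q] P by blast
      \<comment> \<open>The copies are charged to the degree of \<open>v\<close>, not of
        \<open>x\<close>: the label of a closer neighbour is contained in that of
        \<open>v\<close>.\<close>
      have le: "card (label r x) \<le> ?k" if "x \<in> down_nbrs r v" for x
      proof -
        have "card (label r x) \<le> card (label r v)"
          using label_down[OF r s(3) that] by (rule card_mono[rotated]) simp
        also have "\<dots> \<le> ?k"
          using good s(3) by (simp add: good_def)
        finally show ?thesis .
      qed
      have sub: "label r x \<subseteq> {..<n}" for x
        using label_less by blast
      show "runs (Seq (copy_label 6) (copy_label 7)) s1 (4 + 12 * ?k) (?Q (label r v))"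
      proof (rule runs_SeqI_same[where P = "?Q (label r ?p)" and T = "2 + 6 * card (label r ?p)"
            and T' = "2 + 6 * card (label r ?q)"])
        show "runs (copy_label 6) s1 (2 + 6 * card (label r ?p)) (?Q (label r ?p))"
          by (rule runs_mono[OF runs_copy_label[where S = "{}" and l = l and i = i
                  and X = "label r ?p" and A = "arr s 8"]])
            (use s1 st p l mark sub in \<open>auto simp: stored_def copied_def le_SucI\<close>)
        fix s2
        assume Q: "?Q (label r ?p) s2" and same: "same (copy_label 6) s1 s2"
        have s2: "reg s2 2 = i" "reg s2 7 = ?q" "arr s2 6 = arr s 6" "arr s2 7 = arr s 7"
          using same_reg[OF same] same_arr[OF same] s1 by (auto simp: copy_label_def copy_new_def)
        have "slice (arr s 8) (arr s 6 ?q) (arr s 7 ?q) (label r ?q)" "arr s 7 ?q \<le> l"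
          using st q l by (auto simp: stored_def)
        then have "slice (arr s2 8) (arr s 6 ?q) (arr s 7 ?q) (label r ?q)"
          using Q by (elim slice_cong) (simp add: copied_def)
        then show "runs (copy_label 7) s2 (2 + 6 * card (label r ?q)) (?Q (label r v))"
          by (intro runs_mono[OF runs_copy_label[where S = "label r ?p" and l = l and i = i
                  and X = "label r ?q" and A = "arr s 8"]])
            (use Q s2 q l sub un in \<open>auto simp: copied_def\<close>)
      qed (use le[OF p] le[OF q] in simp)
    qed simp
    then have "runs (Seq (each_nbr find_down) (Seq (copy_label 6) (copy_label 7))) ?s (6 + 18 * ?k)
       (\<lambda>s'. slice (arr s' 8) l (reg s' 5) (label r v) \<and> (\<forall>j<l. arr s' 8 j = arr s 8 j) \<and>
       (\<forall>x<n. arr s' 9 x \<le> Suc i))"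
      by (rule runs_mono) (auto simp: copied_def)
    then show ?thesis
      using d s 3 input_n[OF s(1)] by (simp add: write_label_def)
  qed
qed

lemma runs_labels:
  assumes good: "good r" and s: "input s" and ok: "bfs_ok r (arr s 5) (arr s 4)"
    and mark: "\<forall>x<n. arr s 9 x = 0"
  shows "runs labels s (3 + 13 * n + 18 * total) (stored r {..<n})"
proof -
  let ?q = "arr s 5" and ?s = "s\<lparr>reg := (reg s)(5 := 0)\<rparr>"
  have r: "r < n" using good by (simp add: good_def)
  have bij: "bij_betw ?q {..<n} {..<n}" and d: "\<forall>v<n. arr s 4 v = Suc (dd r v)"
    and sorted: "\<And>k l. k \<le> l \<Longrightarrow> l < n \<Longrightarrow> dd r (?q k) \<le> dd r (?q l)"
    using ok by (auto simp: bfs_ok_def)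
  let ?I = "\<lambda>i s'. stored r (?q ` {..<i}) s' \<and> (\<forall>x \<in> ?q ` {..<i}. arr s' 7 x \<le> reg s' 5) \<and>
    (\<forall>x<n. arr s' 9 x \<le> i)"
  have "runs (For 2 (Const 0) (Reg 0) label_step) ?s (2 + 13 * n + 18 * total) (stored r {..<n})"
  proof (rule runs_For[where a = 0 and b = n and I = ?I and T = "\<lambda>i. 11 + 18 * card (nbrs (?q i))"])
    show "2 + (\<Sum>i = 0..<n. 11 + 18 * card (nbrs (?q i)) + 2) \<le> 2 + 13 * n + 18 * total"
      using sum_queue[OF bij] by (simp add: sum.distrib atLeast0LessThan flip: sum_distrib_left)
    show "2 \<notin> rmods label_step"
      by (simp add: label_step_def write_label_def each_nbr_def find_down_def copy_label_def copy_new_def)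
    fix s'
    assume same: "same (For 2 (Const 0) (Reg 0) label_step) ?s s'"
    have s': "input s'" "arr s' 5 = ?q" "arr s' 4 = arr s 4"
      using input_same[OF _ same] s same_arr[OF same]
      by (auto simp: label_step_def write_label_def each_nbr_def find_down_def copy_label_def
          copy_new_def input_def)
    then show "aval (Reg 0) s' = n" by (simp add: input_n)
    show "stored r {..<n} s'" if "?I n s'"
      using that bij by (simp add: bij_betw_def)
    fix i
    assume i: "i < n" "reg s' 2 = i" and I: "?I i s'"
    let ?v = "?q i" and ?l = "reg s' 5"
    let ?s' = "s'\<lparr>reg := (reg s')(8 := ?v), arr := (arr s')(6 := (arr s' 6)(?v := ?l))\<rparr>"
    have v: "?v < n" using bij i by (auto simp: bij_betw_def)
    have fresh: "?v \<notin> ?q ` {..<i}"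
      using bij i by (auto simp: bij_betw_def dest: inj_onD)
    \<comment> \<open>The queue is sorted by distance, so the labels of closer neighbours have been
      written before.\<close>
    have down: "down_nbrs r ?v \<subseteq> ?q ` {..<i}"
    proof
      fix p
      assume p: "p \<in> down_nbrs r ?v"
      then have "p < n" "dd r p < dd r ?v"
        using down_nbrs_less[OF p] by (auto simp: down_nbrs_def)
      then obtain k where k: "k < n" "p = ?q k"
        using bij by (auto simp: bij_betw_def)
      then have "k < i"
        using sorted[of i k] \<open>dd r p < dd r ?v\<close> by (cases "k < i") auto
      then show "p \<in> ?q ` {..<i}" using k by blast
    qed
    have st: "stored r (?q ` {..<i}) ?s'"
      unfolding stored_def
    proof
      fix x
      assume x: "x \<in> ?q ` {..<i}"
      then have "x \<noteq> ?v" using fresh by blast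
      moreover have "slice (arr s' 8) (arr s' 6 x) (arr s' 7 x) (label r x)"
        using I x unfolding stored_def by blast
      ultimately show "slice (arr ?s' 8) (arr ?s' 6 x) (arr ?s' 7 x) (label r x)"
        by simp
    qed
    let ?Q = "\<lambda>s''. slice (arr s'' 8) ?l (reg s'' 5) (label r ?v) \<and> (\<forall>j<?l. arr s'' 8 j = arr s' 8 j) \<and>
       (\<forall>x<n. arr s'' 9 x \<le> Suc i)"
    have "stored r (down_nbrs r ?v) ?s'"
      using st down unfolding stored_def by blast
    moreover have "\<forall>x \<in> down_nbrs r ?v. arr ?s' 7 x \<le> ?l"
      using I down by auto
    moreover have "input ?s'"
      using s'(1) by (simp add: input_def)
    ultimately have "runs write_label ?s' (8 + 18 * card (nbrs ?v)) ?Q"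
      using runs_write_label[OF good, of ?s' ?v i ?l] v i(2) s'(3) d I by simp
    then have "runs (Seq write_label (Put 7 (Reg 8) (Reg 5))) ?s' (9 + 18 * card (nbrs ?v))
        (?I (Suc i))"
    proof (rule runs_SeqI_same[where T' = 1])
      fix s2
      assume Q: "?Q s2" and same: "same write_label ?s' s2"
      have s2: "reg s2 8 = ?v" "arr s2 6 = (arr s' 6)(?v := ?l)" "arr s2 7 = arr s' 7"
        using same_reg[OF same] same_arr[OF same]
        by (auto simp: write_label_def each_nbr_def find_down_def copy_label_def copy_new_def)
      have "?l \<le> reg s2 5" using Q slice_le by blast
      have old: "slice (arr s2 8) (arr s2 6 x) (arr s2 7 x) (label r x) \<and> arr s2 7 x \<le> reg s2 5 \<and> x \<noteq> ?v"
        if x: "x \<in> ?q ` {..<i}" for x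
      proof -
        have "x \<noteq> ?v" using x fresh by blast
        have en: "arr s' 7 x \<le> ?l" using I x by blast
        have "slice (arr s' 8) (arr s' 6 x) (arr s' 7 x) (label r x)"
          using I x unfolding stored_def by blast
        then have "slice (arr s2 8) (arr s' 6 x) (arr s' 7 x) (label r x)"
          by (rule slice_cong) (use Q en in simp)
        then show ?thesis
          using \<open>x \<noteq> ?v\<close> en \<open>?l \<le> reg s2 5\<close> by (simp add: s2)
      qed
      have split: "?q ` {..<Suc i} = insert ?v (?q ` {..<i})"
        by (simp add: lessThan_Suc)
      let ?s3 = "s2\<lparr>arr := (arr s2)(7 := (arr s2 7)(?v := reg s2 5))\<rparr>"
      have "stored r (?q ` {..<Suc i}) ?s3"
        unfolding stored_def
      proof
        fix x
        assume x: "x \<in> ?q ` {..<Suc i}"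
        show "slice (arr ?s3 8) (arr ?s3 6 x) (arr ?s3 7 x) (label r x)"
        proof (cases "x = ?v")
          case True
          then show ?thesis using Q s2 by simp
        next
          case False
          then have "x \<in> ?q ` {..<i}" using x unfolding split by blast
          then show ?thesis using old[of x] False by simp
        qed
      qed
      moreover have "\<forall>x \<in> ?q ` {..<Suc i}. arr ?s3 7 x \<le> reg ?s3 5"
      proof
        fix x
        assume x: "x \<in> ?q ` {..<Suc i}"
        then show "arr ?s3 7 x \<le> reg ?s3 5"
          using old[of x] unfolding split by (cases "x = ?v") auto
      qed
      ultimately have "?I (Suc i) ?s3"
        using Q by simp
      then show "runs (Put 7 (Reg 8) (Reg 5)) s2 1 (?I (Suc i))"
        by (simp add: s2(1))
    qed simp
    then have "runs label_step s' (11 + 18 * card (nbrs ?v)) (?I (Suc i))"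
      by (simp add: label_step_def i s')
    then show "runs label_step s' (11 + 18 * card (nbrs ?v))
        (\<lambda>s''. ?I (Suc i) (s''\<lparr>reg := (reg s'')(2 := Suc i)\<rparr>))"
      by (rule runs_mono) (simp_all add: stored_def)
  qed (use mark in \<open>auto simp: stored_def\<close>)
  then show ?thesis
    by (simp add: labels_def)
qed

end

section \<open>The second root\<close>

definition count :: com where
  "count = For 2 (Const 0) (Reg 0) (For 3 (Get 6 (Reg 2)) (Get 7 (Reg 2))
     (Put 10 (Get 8 (Reg 3)) (Succ (Get 10 (Get 8 (Reg 3))))))"

definition check :: com where
  "check = For 3 (Get 6 (Reg 8)) (Get 7 (Reg 8))
     (Ite (Less (Sub (Reg 0) (Get 10 (Get 8 (Reg 3)))) (Get 10 (Get 8 (Reg 3))))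
       Skip (Assign 10 (Const 0)))"

text \<open>As the queue is sorted by distance, overwriting register 9 with each candidate leaves a
  farthest one there. The \<open>Succ\<close> matches the distance plus one in array 4.\<close>

definition select_step :: com where
  "select_step = Seq (Assign 8 (Get 5 (Reg 2))) (Seq (Assign 10 (Const 1)) (Seq check
     (Ite (Conj (Equal (Reg 10) (Const 1))
                (Equal (Succ (Sub (Get 7 (Reg 8)) (Get 6 (Reg 8)))) (Get 4 (Reg 8))))
       (Assign 9 (Reg 8)) Skip)))"

definition select :: com where
  "select = Seq (Assign 9 (Reg 1))
     (Seq (For 2 (Const 0) (Reg 0) select_step) (Assign 1 (Reg 9)))"

definition emit_label :: com where
  "emit_label = For 3 (Get 6 (Reg 2)) (Get 7 (Reg 2))
     (Seq (Put 3 (Reg 5) (Get 8 (Reg 3))) (Assign 5 (Succ (Reg 5))))"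

definition emit :: com where
  "emit = Seq (Assign 5 (Const 0))
     (Seq (For 2 (Const 0) (Reg 0) (Seq (Put 2 (Reg 2) (Reg 5)) emit_label))
       (Put 2 (Reg 0) (Reg 5)))"

text \<open>The guard catches the empty graph, which has no root.\<close>

definition embed :: com where
  "embed = Ite (Less (Const 0) (Reg 0))
     (Seq min_degree (Seq bfs (Seq labels (Seq count (Seq select (Seq bfs (Seq labels emit)))))))
     Skip"

lemmas program_defs = min_degree_def bfs_def reset_def search_def visit_def each_nbr_def labels_def
  label_step_def write_label_def find_down_def copy_label_def copy_new_def count_def select_def
  select_step_def check_def

lemma snoc_stored:
  "\<forall>k<length xs. A k = xs ! k \<Longrightarrow> \<forall>k<length (xs @ [x]). (A(length xs := x)) k = (xs @ [x]) ! k"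
  by (simp add: nth_append less_Suc_eq)

lemma sum_affine:
  fixes g :: "nat \<Rightarrow> nat"
  shows "(\<Sum>i=0..<n. a + b * g i + c) = (a + c) * n + b * (\<Sum>i<n. g i)"
  by (simp add: sum.distrib atLeast0LessThan sum_distrib_left algebra_simps)

context down_closed
begin

lemma storedD: "stored r X s \<Longrightarrow> x \<in> X \<Longrightarrow> slice (arr s 8) (arr s 6 x) (arr s 7 x) (label r x)"
  by (simp add: stored_def)

lemma stored_same: "stored r X s \<Longrightarrow> same c s s' \<Longrightarrow> {6, 7, 8} \<inter> amods c = {} \<Longrightarrow> stored r X s'"
  by (simp add: stored_def same_arr)

lemma good_label_le: "good r \<Longrightarrow> v < n \<Longrightarrow> card (label r v) \<le> card (nbrs v)"
  by (simp add: good_def)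

section \<open>Correctness of counting and selection\<close>

lemma runs_count:
  assumes good: "good r" and s: "input s" and st: "stored r {..<n} s"
    and zero: "\<forall>x<n. arr s 10 x = 0"
  shows "runs count s (2 + 4 * n + 3 * total) (\<lambda>s'. \<forall>x<n. arr s' 10 x = hits r x)"
proof -
  let ?inner = "For 3 (Get 6 (Reg 2)) (Get 7 (Reg 2))
     (Put 10 (Get 8 (Reg 3)) (Succ (Get 10 (Get 8 (Reg 3)))))"
  let ?N = "\<lambda>i x. card {y. y < i \<and> x \<in> label r y}"
  let ?I = "\<lambda>i s'. \<forall>x<n. arr s' 10 x = ?N i x"
  show ?thesis
    unfolding count_def
  proof (rule runs_For[where a = 0 and b = n and I = ?I and T = "\<lambda>i. 2 + 3 * card (nbrs i)"])
    show "2 + (\<Sum>i = 0..<n. 2 + 3 * card (nbrs i) + 2) \<le> 2 + 4 * n + 3 * total"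
      unfolding sum_affine total_def by simp
    fix s'
    assume same: "same (For 2 (Const 0) (Reg 0) ?inner) s s'"
    then show "aval (Reg 0) s' = n"
      using input_n[OF s] by (simp add: same_reg)
    show "\<forall>x<n. arr s' 10 x = hits r x" if "?I n s'"
      using that by (simp add: hits_def)
    fix i
    assume i: "i < n" "reg s' 2 = i" and I: "?I i s'"
    let ?A = "arr s' 8" and ?a = "arr s' 6 i" and ?b = "arr s' 7 i"
    have sl: "slice ?A ?a ?b (label r i)"
      using storedD[OF stored_same[OF st same]] i by simp
    let ?J = "\<lambda>j s''. \<forall>x<n. arr s'' 10 x = ?N i x + (if x \<in> ?A ` {?a..<j} then 1 else 0)"
    have N: "?N (Suc i) x = ?N i x + (if x \<in> label r i then 1 else 0)" for x
    proof -
      have "{y. y < Suc i \<and> x \<in> label r y} =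
          (if x \<in> label r i then insert i {y. y < i \<and> x \<in> label r y} else {y. y < i \<and> x \<in> label r y})"
        by (auto simp: less_Suc_eq)
      then show ?thesis by simp
    qed
    show "runs ?inner s' (2 + 3 * card (nbrs i)) (\<lambda>s''. ?I (Suc i) (s''\<lparr>reg := (reg s'')(2 := Suc i)\<rparr>))"
    proof (rule runs_For[where a = ?a and b = ?b and I = ?J and T = "\<lambda>_. 1"])
      show "2 + (\<Sum>j = ?a..<?b. 1 + 2) \<le> 2 + 3 * card (nbrs i)"
        using slice_card[OF sl] good_label_le[OF good i(1)] by simp
      fix s2 :: state
      assume same2: "same ?inner s' s2"
      have s2: "arr s2 8 = ?A" "arr s2 7 i = ?b" "reg s2 2 = i"
        using same_arr[OF same2] same_reg[OF same2] i by simp_all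
      then show "aval (Get 7 (Reg 2)) s2 = ?b" by simp
      show "?I (Suc i) (s2\<lparr>reg := (reg s2)(2 := Suc i)\<rparr>)" if "?J ?b s2"
        using that by (simp add: N slice_end[OF sl])
      fix j
      assume j: "?a \<le> j" "j < ?b" "reg s2 3 = j" and J: "?J j s2"
      show "runs (Put 10 (Get 8 (Reg 3)) (Succ (Get 10 (Get 8 (Reg 3))))) s2 1
          (\<lambda>s3. ?J (Suc j) (s3\<lparr>reg := (reg s3)(3 := Suc j)\<rparr>))"
        using J slice_fresh[OF sl j(1,2)] by (simp add: j(3) s2 image_Suc_upt[OF j(1)])
    qed (use I i slice_le[OF sl] in auto)
  qed (use zero in auto)
qed

lemma runs_check:
  assumes good: "good r" and s: "input s" "reg s 8 = v" "v < n" "reg s 10 = 1"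
    and st: "stored r {..<n} s" and hits: "\<forall>x<n. arr s 10 x = hits r x"
  shows "runs check s (2 + 4 * card (nbrs v))
    (\<lambda>s'. reg s' 10 = 1 \<longleftrightarrow> (\<forall>x\<in>label r v. n - hits r x < hits r x))"
proof -
  let ?A = "arr s 8" and ?a = "arr s 6 v" and ?b = "arr s 7 v"
  let ?I = "\<lambda>j s'. reg s' 10 = 1 \<longleftrightarrow> (\<forall>x\<in>?A ` {?a..<j}. n - hits r x < hits r x)"
  let ?c = "Ite (Less (Sub (Reg 0) (Get 10 (Get 8 (Reg 3)))) (Get 10 (Get 8 (Reg 3))))
       Skip (Assign 10 (Const 0))"
  have sl: "slice ?A ?a ?b (label r v)"
    using storedD[OF st] s by simp
  show ?thesis
    unfolding check_def
  proof (rule runs_For[where a = ?a and b = ?b and I = ?I and T = "\<lambda>_. 2"])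
    show "2 + (\<Sum>j = ?a..<?b. 2 + 2) \<le> 2 + 4 * card (nbrs v)"
      using slice_card[OF sl] good_label_le[OF good s(3)] by simp
    fix s'
    assume same: "same (For 3 (Get 6 (Reg 8)) (Get 7 (Reg 8)) ?c) s s'"
    have s': "arr s' 8 = ?A" "arr s' 7 v = ?b" "reg s' 8 = v" "reg s' 0 = n" "arr s' 10 = arr s 10"
      using same_arr[OF same] same_reg[OF same] s input_n[OF s(1)] by simp_all
    then show "aval (Get 7 (Reg 8)) s' = ?b" by simp
    show "reg s' 10 = 1 \<longleftrightarrow> (\<forall>x\<in>label r v. n - hits r x < hits r x)" if "?I ?b s'"
      using that by (simp only: slice_end[OF sl])
    fix j
    assume j: "?a \<le> j" "j < ?b" "reg s' 3 = j" and I: "?I j s'"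
    have "?A j < n"
      using slice_mem[OF sl j(1,2)] label_less by blast
    then show "runs ?c s' 2 (\<lambda>s''. ?I (Suc j) (s''\<lparr>reg := (reg s'')(3 := Suc j)\<rparr>))"
      using I hits by (simp only: image_Suc_upt[OF j(1)]) (simp add: j(3) s')
  qed (use s slice_le[OF sl] in auto)
qed

lemma runs_select:
  assumes good: "good r" and s: "input s" "reg s 1 = r" and ok: "bfs_ok r (arr s 5) (arr s 4)"
    and st: "stored r {..<n} s" and hits: "\<forall>x<n. arr s 10 x = hits r x"
  shows "runs select s (4 + 8 * n + 4 * total)
    (\<lambda>s'. candidate r (reg s' 1) \<and> (\<forall>y. candidate r y \<longrightarrow> dd r y \<le> dd r (reg s' 1)))"
proof -
  let ?q = "arr s 5" and ?s = "s\<lparr>reg := (reg s)(9 := r)\<rparr>"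
  have r: "r < n" using good by (simp add: good_def)
  have bij: "bij_betw ?q {..<n} {..<n}" and d: "\<forall>v<n. arr s 4 v = Suc (dd r v)"
    and sorted: "\<And>k l. k \<le> l \<Longrightarrow> l < n \<Longrightarrow> dd r (?q k) \<le> dd r (?q l)"
    using ok by (auto simp: bfs_ok_def)
  let ?I = "\<lambda>i s'. candidate r (reg s' 9) \<and>
    (\<forall>k<i. candidate r (?q k) \<longrightarrow> dd r (?q k) \<le> dd r (reg s' 9)) \<and>
    (\<forall>k. i \<le> k \<longrightarrow> k < n \<longrightarrow> dd r (reg s' 9) \<le> dd r (?q k))"
  have "runs (For 2 (Const 0) (Reg 0) select_step) ?s (2 + 8 * n + 4 * total) (?I n)"
  proof (rule runs_For[where a = 0 and b = n and I = ?I and T = "\<lambda>i. 6 + 4 * card (nbrs (?q i))"])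
    show "2 + (\<Sum>i = 0..<n. 6 + 4 * card (nbrs (?q i)) + 2) \<le> 2 + 8 * n + 4 * total"
      unfolding sum_affine sum_queue[OF bij] by simp
    fix s'
    assume same: "same (For 2 (Const 0) (Reg 0) select_step) ?s s'"
    have in': "input s'" and st': "stored r {..<n} s'"
      and s': "arr s' 5 = ?q" "arr s' 4 = arr s 4" "arr s' 10 = arr s 10"
      using input_same[OF _ same] stored_same[OF _ same] s st same_arr[OF same]
      by (auto simp: select_step_def check_def input_def stored_def)
    then show "aval (Reg 0) s' = n" by (simp add: input_n)
    fix i
    assume i: "i < n" "reg s' 2 = i" and I: "?I i s'"
    let ?v = "?q i"
    let ?s' = "s'\<lparr>reg := (reg s')(8 := ?v, 10 := 1)\<rparr>"
    have v: "?v < n" using bij i by (auto simp: bij_betw_def)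
    have sl: "slice (arr s' 8) (arr s' 6 ?v) (arr s' 7 ?v) (label r ?v)"
      using storedD[OF st'] v by simp
    let ?c = "Ite (Conj (Equal (Reg 10) (Const 1))
                (Equal (Succ (Sub (Get 7 (Reg 8)) (Get 6 (Reg 8)))) (Get 4 (Reg 8))))
       (Assign 9 (Reg 8)) Skip"
    have "runs check ?s' (2 + 4 * card (nbrs ?v))
      (\<lambda>s2. reg s2 10 = 1 \<longleftrightarrow> (\<forall>x\<in>label r ?v. n - hits r x < hits r x))"
      by (rule runs_check[OF good])
        (use in' st' v hits s' in \<open>auto simp: input_def stored_def\<close>)
    then have "runs (Seq check ?c) ?s' (4 + 4 * card (nbrs ?v)) (?I (Suc i))"
    proof (rule runs_SeqI_same[where T' = 2])
      fix s2 :: state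
      assume Q: "reg s2 10 = 1 \<longleftrightarrow> (\<forall>x\<in>label r ?v. n - hits r x < hits r x)"
        and same2: "same check ?s' s2"
      have s2: "reg s2 8 = ?v" "reg s2 9 = reg s' 9" "arr s2 4 = arr s 4"
        "arr s2 6 = arr s' 6" "arr s2 7 = arr s' 7"
        using same_reg[OF same2] same_arr[OF same2] s' by (auto simp: check_def)
      have cand: "bval (Conj (Equal (Reg 10) (Const 1))
          (Equal (Succ (Sub (Get 7 (Reg 8)) (Get 6 (Reg 8)))) (Get 4 (Reg 8)))) s2 \<longleftrightarrow> candidate r ?v"
        using Q d v slice_card[OF sl] by (auto simp: s2 candidate_def)
      have "?I (Suc i) (s2\<lparr>reg := (reg s2)(9 := ?v)\<rparr>)" if "candidate r ?v"
        using that i sorted by (simp add: less_Suc_eq_le)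
      moreover have "?I (Suc i) s2" if "\<not> candidate r ?v"
        using that I by (simp add: s2 less_Suc_eq)
      ultimately show "runs ?c s2 2 (?I (Suc i))"
        unfolding runs_Ite cand by (simp add: s2(1))
    qed simp
    then have "runs select_step s' (6 + 4 * card (nbrs ?v)) (?I (Suc i))"
      by (simp add: select_step_def i s')
    then show "runs select_step s' (6 + 4 * card (nbrs ?v))
        (\<lambda>s''. ?I (Suc i) (s''\<lparr>reg := (reg s'')(2 := Suc i)\<rparr>))"
      by (rule runs_mono) simp_all
  qed (use candidate_root[OF r] in \<open>auto simp: select_step_def check_def\<close>)
  then have "runs (Seq (For 2 (Const 0) (Reg 0) select_step) (Assign 1 (Reg 9))) ?s
      (3 + 8 * n + 4 * total)
    (\<lambda>s'. candidate r (reg s' 1) \<and> (\<forall>y. candidate r y \<longrightarrow> dd r y \<le> dd r (reg s' 1)))"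
  proof (rule runs_SeqI[where T' = 1])
    fix s' :: state
    assume I: "?I n s'"
    have "dd r y \<le> dd r (reg s' 9)" if "candidate r y" for y
    proof -
      have "y \<in> ?q ` {..<n}"
        using that bij by (simp add: candidate_def bij_betw_def)
      then show ?thesis using that I by blast
    qed
    then show "runs (Assign 1 (Reg 9)) s' 1
      (\<lambda>s'. candidate r (reg s' 1) \<and> (\<forall>y. candidate r y \<longrightarrow> dd r y \<le> dd r (reg s' 1)))"
      using I by simp
  qed simp
  then show ?thesis
    by (simp add: select_def s add.assoc)
qed

section \<open>Writing the output\<close>

lemma runs_emit:
  assumes good: "good r" and s: "input s" and st: "stored r {..<n} s"
  shows "runs emit s (4 + 5 * n + 4 * total) (\<lambda>s'. \<exists>ones. length ones = n \<and>
    (\<forall>v<n. distinct (ones ! v) \<and> set (ones ! v) = label r v) \<and> stored_lists s' 2 3 ones)"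
proof -
  let ?L = "\<lambda>v. map (arr s 8) [arr s 6 v..<arr s 7 v]"
  \<comment> \<open>The content of array 3 once the vertices below \<open>i\<close> have been
    written; its length is the offset of vertex \<open>i\<close>.\<close>
  let ?cc = "\<lambda>i. concat (map ?L [0..<i])"
  let ?ones = "map ?L [0..<n]"
  let ?s = "s\<lparr>reg := (reg s)(5 := 0)\<rparr>"
  let ?c = "Seq (Put 2 (Reg 2) (Reg 5)) emit_label"
  let ?I = "\<lambda>i s'. reg s' 5 = length (?cc i) \<and> (\<forall>k<i. arr s' 2 k = length (?cc k)) \<and>
    (\<forall>j<length (?cc i). arr s' 3 j = ?cc i ! j)"
  have ones: "distinct (?ones ! v) \<and> set (?ones ! v) = label r v" if "v < n" for v
    using storedD[OF st, of v] that by (simp add: slice_def distinct_map)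
  have loop: "runs (For 2 (Const 0) (Reg 0) ?c) ?s (2 + 5 * n + 4 * total) (\<lambda>s'. ?I n s' \<and> reg s' 0 = n)"
  proof (rule runs_For[where a = 0 and b = n and I = ?I and T = "\<lambda>i. 3 + 4 * card (nbrs i)"])
    show "2 + (\<Sum>i = 0..<n. 3 + 4 * card (nbrs i) + 2) \<le> 2 + 5 * n + 4 * total"
      unfolding sum_affine total_def by simp
    fix s'
    assume same: "same (For 2 (Const 0) (Reg 0) ?c) ?s s'"
    have s': "arr s' 8 = arr s 8" "arr s' 7 = arr s 7" "arr s' 6 = arr s 6" "reg s' 0 = n"
      using same_arr[OF same] same_reg[OF same] input_n[OF s] by (simp_all add: emit_label_def)
    then show "aval (Reg 0) s' = n" by simp
    show "?I n s' \<and> reg s' 0 = n" if "?I n s'" using that s' by simp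
    fix i
    assume i: "i < n" "reg s' 2 = i" and I: "?I i s'"
    let ?s2 = "s'\<lparr>arr := (arr s')(2 := (arr s' 2)(i := reg s' 5))\<rparr>"
    let ?A = "arr s 8" and ?a = "arr s 6 i" and ?b = "arr s 7 i"
    have sl: "slice ?A ?a ?b (label r i)"
      using storedD[OF st] i by simp
    let ?xs = "\<lambda>j. ?cc i @ map ?A [?a..<j]"
    let ?J = "\<lambda>j s3. reg s3 5 = length (?xs j) \<and> (\<forall>k<length (?xs j). arr s3 3 k = ?xs j ! k)"
    have "runs emit_label ?s2 (2 + 4 * card (nbrs i)) (\<lambda>s3. ?I (Suc i) (s3\<lparr>reg := (reg s3)(2 := Suc i)\<rparr>))"
      unfolding emit_label_def
    proof (rule runs_For[where a = ?a and b = ?b and I = ?J and T = "\<lambda>_. 2"])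
      show "2 + (\<Sum>j = ?a..<?b. 2 + 2) \<le> 2 + 4 * card (nbrs i)"
        using slice_card[OF sl] good_label_le[OF good i(1)] by simp
      fix s3 :: state
      assume same3: "same (For 3 (Get 6 (Reg 2)) (Get 7 (Reg 2))
          (Seq (Put 3 (Reg 5) (Get 8 (Reg 3))) (Assign 5 (Succ (Reg 5))))) ?s2 s3"
      have s3: "arr s3 8 = ?A" "arr s3 7 i = ?b" "reg s3 2 = i"
        "arr s3 2 = (arr s' 2)(i := length (?cc i))"
        using same_arr[OF same3] same_reg[OF same3] i s' I by simp_all
      then show "aval (Get 7 (Reg 2)) s3 = ?b" by simp
      show "?I (Suc i) (s3\<lparr>reg := (reg s3)(2 := Suc i)\<rparr>)" if "?J ?b s3"
        using that I by (simp add: s3 less_Suc_eq)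
      fix j
      assume j: "?a \<le> j" "j < ?b" "reg s3 3 = j" and J: "?J j s3"
      have xs: "?xs (Suc j) = ?xs j @ [?A j]"
        using j by simp
      show "runs (Seq (Put 3 (Reg 5) (Get 8 (Reg 3))) (Assign 5 (Succ (Reg 5)))) s3 2
          (\<lambda>s4. ?J (Suc j) (s4\<lparr>reg := (reg s4)(3 := Suc j)\<rparr>))"
        using snoc_stored[of "?xs j" "arr s3 3" "?A j"] J length_append_singleton[of "?xs j" "?A j"]
        unfolding xs
        by (simp add: j(3) s3(1) del: length_append append_assoc)
    qed (use I i s' slice_le[OF sl] in auto)
    then show "runs ?c s' (3 + 4 * card (nbrs i)) (\<lambda>s3. ?I (Suc i) (s3\<lparr>reg := (reg s3)(2 := Suc i)\<rparr>))"
      by (simp add: i)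
  qed (auto simp: emit_label_def)
  have "runs (Seq (For 2 (Const 0) (Reg 0) ?c) (Put 2 (Reg 0) (Reg 5))) ?s (3 + 5 * n + 4 * total)
    (\<lambda>s'. stored_lists s' 2 3 ?ones)"
  proof (rule runs_SeqI[OF loop, where T' = 1])
    fix s' :: state
    assume I: "?I n s' \<and> reg s' 0 = n"
    have off: "offsets ?ones = map (\<lambda>i. length (?cc i)) [0..<Suc n]"
      by (auto simp: offsets_def take_map simp del: upt_Suc)
    show "runs (Put 2 (Reg 0) (Reg 5)) s' 1 (\<lambda>s'. stored_lists s' 2 3 ?ones)"
      unfolding stored_lists_def off using I
      by (simp add: less_Suc_eq nth_append del: upt_Suc)
  qed simp
  then have "runs emit s (4 + 5 * n + 4 * total) (\<lambda>s'. stored_lists s' 2 3 ?ones)"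
    by (simp add: emit_def add.assoc)
  then show ?thesis
    by (rule runs_mono) (use ones in \<open>auto intro!: exI[of _ ?ones]\<close>)
qed

section \<open>The complete program\<close>

lemma runs_embed:
  assumes s: "input s" and zero: "\<forall>x<n. arr s 10 x = 0"
  shows "runs embed s (99 + 124 * total) (\<lambda>s'. reg s' 0 = n \<and>
    (\<exists>w ones. central w \<and> length ones = n \<and>
      (\<forall>v<n. distinct (ones ! v) \<and> set (ones ! v) = label w v) \<and> stored_lists s' 2 3 ones))"
    (is "runs embed s ?T ?Q")
proof -
  let ?B = "7 + 9 * n + 6 * total" and ?L = "3 + 13 * n + 18 * total"
  let ?O = "4 + 5 * n + 4 * total" and ?C = "4 + 8 * n + 4 * total" and ?N = "2 + 4 * n + 3 * total"
  let ?c = "Seq min_degree (Seq bfs (Seq labels (Seq count (Seq select (Seq bfs (Seq labels emit))))))"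
  have "runs ?c s (33 + 65 * n + 59 * total) (\<lambda>s'. \<exists>w ones. central w \<and> length ones = n \<and>
      (\<forall>v<n. distinct (ones ! v) \<and> set (ones ! v) = label w v) \<and> stored_lists s' 2 3 ones)"
      (is "runs _ _ _ ?R")
  proof (rule runs_SeqI_same[OF runs_min_degree[OF s], where T' = "?B + (?L + (?N + (?C + (?B + (?L + ?O)))))"])
    fix s1 :: state
    let ?u = "reg s1 1"
    assume u: "?u < n \<and> (\<forall>v<n. card (nbrs ?u) \<le> card (nbrs v))" and same: "same min_degree s s1"
    have good: "good ?u" using u good_min_degree by blast
    have i1: "input s1" using input_same[OF s same] by (simp add: program_defs)
    have z1: "\<forall>x<n. arr s1 10 x = 0"
      using zero same_arr[OF same] by (simp add: program_defs)
    show "runs (Seq bfs (Seq labels (Seq count (Seq select (Seq bfs (Seq labels emit)))))) s1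
      (?B + (?L + (?N + (?C + (?B + (?L + ?O)))))) ?R"
    proof (rule runs_SeqI_same[OF runs_bfs[OF i1 refl]])
      fix s2 :: state
      assume ok: "bfs_ok ?u (arr s2 5) (arr s2 4) \<and> (\<forall>v<n. arr s2 9 v = 0)" and same: "same bfs s1 s2"
      have i2: "input s2" using input_same[OF i1 same] by (simp add: program_defs)
      have s2: "reg s2 1 = ?u" "\<forall>x<n. arr s2 10 x = 0"
        using z1 same_arr[OF same] same_reg[OF same] by (simp_all add: program_defs)
      show "runs (Seq labels (Seq count (Seq select (Seq bfs (Seq labels emit))))) s2
        (?L + (?N + (?C + (?B + (?L + ?O))))) ?R"
      proof (rule runs_SeqI_same[OF runs_labels[OF good i2]])
        fix s3 :: state
        assume st: "stored ?u {..<n} s3" and same: "same labels s2 s3"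
        have i3: "input s3" using input_same[OF i2 same] by (simp add: program_defs)
        have s3: "reg s3 1 = ?u" "arr s3 4 = arr s2 4" "arr s3 5 = arr s2 5" "\<forall>x<n. arr s3 10 x = 0"
          using s2 same_arr[OF same] same_reg[OF same] by (simp_all add: program_defs)
        show "runs (Seq count (Seq select (Seq bfs (Seq labels emit)))) s3
          (?N + (?C + (?B + (?L + ?O)))) ?R"
        proof (rule runs_SeqI_same[OF runs_count[OF good i3 st s3(4)]])
          fix s4 :: state
          assume hits: "\<forall>x<n. arr s4 10 x = hits ?u x" and same: "same count s3 s4"
          have i4: "input s4" using input_same[OF i3 same] by (simp add: program_defs)
          have st4: "stored ?u {..<n} s4" using stored_same[OF st same] by (simp add: program_defs)
          have s4: "reg s4 1 = ?u" "bfs_ok ?u (arr s4 5) (arr s4 4)"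
            using s3 ok same_arr[OF same] same_reg[OF same] by (simp_all add: program_defs)
          show "runs (Seq select (Seq bfs (Seq labels emit))) s4 (?C + (?B + (?L + ?O))) ?R"
          proof (rule runs_SeqI_same[OF runs_select[OF good i4 s4 st4 hits]])
            fix s5 :: state
            let ?w = "reg s5 1"
            assume w: "candidate ?u ?w \<and> (\<forall>y. candidate ?u y \<longrightarrow> dd ?u y \<le> dd ?u ?w)"
              and same: "same select s4 s5"
            have central: "central ?w"
              using central_candidate[of ?u ?w] u w by blast
            then have wn: "?w < n" by (simp add: central_def)
            have i5: "input s5" using input_same[OF i4 same] by (simp add: program_defs)
            show "runs (Seq bfs (Seq labels emit)) s5 (?B + (?L + ?O)) ?R"
            proof (rule runs_SeqI_same[OF runs_bfs[OF i5 refl wn]])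
              fix s6 :: state
              assume ok: "bfs_ok ?w (arr s6 5) (arr s6 4) \<and> (\<forall>v<n. arr s6 9 v = 0)"
                and same: "same bfs s5 s6"
              have i6: "input s6" using input_same[OF i5 same] by (simp add: program_defs)
              show "runs (Seq labels emit) s6 (?L + ?O) ?R"
              proof (rule runs_SeqI_same[OF runs_labels[OF good_central[OF central] i6]])
                fix s7 :: state
                assume st: "stored ?w {..<n} s7" and same: "same labels s6 s7"
                have i7: "input s7" using input_same[OF i6 same] by (simp add: program_defs)
                show "runs emit s7 ?O ?R"
                  by (rule runs_mono[OF runs_emit[OF good_central[OF central] i7 st]])
                    (use central in auto)
              qed (use ok in auto)
            qed simp
          qed simp
        qed simp
      qed (use ok in auto)
    qed (use u in auto)
  qed simp
  \<comment> \<open>No command assigns register 0, so it still holds \<open>n\<close>, which serves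
    as the dimension in the output.\<close>
  then have "runs ?c s (33 + 65 * n + 59 * total) (\<lambda>s'. ?R s' \<and> same ?c s s')"
    by (rule runs_same)
  then have "runs ?c s (98 + 124 * total) ?Q"
  proof (rule runs_mono)
    \<comment> \<open>From \<open>n \<le> total + 1\<close>: the constant becomes
      \<open>33 + 65\<close> and the factor \<open>65 + 59\<close>.\<close>
    show "33 + 65 * n + 59 * total \<le> 98 + 124 * total"
      using n_le_sum_degrees unfolding total_def by linarith
    fix s'
    assume "?R s' \<and> same ?c s s'"
    then show "?Q s'"
      using input_n[OF s] same_reg[of ?c s s' 0] by (simp add: program_defs emit_def emit_label_def)
  qed
  then show ?thesis
    using n_pos input_n[OF s] by (simp add: embed_def)
qed

end

section \<open>Words, walks and adjacency lists\<close>

definition ones_of :: "bool list \<Rightarrow> nat set" where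
  "ones_of w = {i. i < length w \<and> w ! i}"

lemma hamming_ones_of:
  assumes "length u = length v"
  shows "hamming u v = card (sym_diff (ones_of u) (ones_of v))"
proof -
  have "{i. i < length u \<and> u ! i \<noteq> v ! i} = sym_diff (ones_of u) (ones_of v)"
    using assms by (auto simp: ones_of_def)
  then show ?thesis
    by (simp add: hamming_def)
qed

lemma ones_of_inj: "length u = length v \<Longrightarrow> ones_of u = ones_of v \<Longrightarrow> u = v"
  by (rule nth_equalityI) (auto simp: ones_of_def set_eq_iff)

lemma list_all2_le_iff: "length u = length v \<Longrightarrow> list_all2 (\<le>) u v \<longleftrightarrow> ones_of u \<subseteq> ones_of v"
  by (auto simp: ones_of_def list_all2_conv_all_nth)

lemma ones_of_map: "S \<subseteq> {..<h} \<Longrightarrow> ones_of (map (\<lambda>i. i \<in> S) [0..<h]) = S"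
  by (auto simp: ones_of_def)

text \<open>Replacing words by the sets of their ones turns \<open>\<le>\<close> into inclusion and
  Hamming distance into the size of the symmetric difference. The family is down-closed because a
  word below \<open>g v\<close> is also below the element of \<open>X\<close> that lies above
  \<open>g v\<close>.\<close>

lemma daisy_cube_sets:
  assumes "is_daisy_cube G"
  shows "\<exists>f :: 'a \<Rightarrow> nat set. (\<forall>v \<in> verts G. finite (f v)) \<and> inj_on f (verts G) \<and>
    (\<forall>v \<in> verts G. \<forall>S \<subseteq> f v. \<exists>u \<in> verts G. f u = S) \<and>
    (\<forall>u \<in> verts G. \<forall>v \<in> verts G. {u, v} \<in> edges G \<longleftrightarrow> card (sym_diff (f u) (f v)) = 1)"
proof -
  obtain h X g where X: "X \<subseteq> words h"
    and bij: "bij_betw g (verts G) (verts (daisy_cube h X))"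
    and edge: "\<And>u v. u \<in> verts G \<Longrightarrow> v \<in> verts G \<Longrightarrow>
      {u, v} \<in> edges G \<longleftrightarrow> {g u, g v} \<in> edges (daisy_cube h X)"
    using assms unfolding is_daisy_cube_def isomorphic_def by blast
  let ?D = "{w \<in> words h. \<exists>x\<in>X. list_all2 (\<le>) w x}"
  have V: "verts (daisy_cube h X) = ?D"
    by (auto simp: daisy_cube_def induced_subgraph_def hypercube_def)
  have E: "{a, b} \<in> edges (daisy_cube h X) \<longleftrightarrow> hamming a b = 1" if "a \<in> ?D" "b \<in> ?D" for a b
  proof -
    \<comment> \<open>Edges are unordered pairs, so matching \<open>{a, b}\<close> with an edge of
      the hypercube may swap the words.\<close>
    have "hamming b a = hamming a b"
      using that by (simp add: words_def hamming_ones_of Un_commute)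
    then show ?thesis
      using that unfolding daisy_cube_def induced_subgraph_def hypercube_def
      by (auto simp: doubleton_eq_iff)
  qed
  have g: "g v \<in> ?D" if "v \<in> verts G" for v
    using bij that unfolding V bij_betw_def by blast
  then have len: "length (g v) = h" if "v \<in> verts G" for v
    using that by (simp add: words_def)
  let ?f = "\<lambda>v. ones_of (g v)"
  show ?thesis
  proof (intro exI[of _ ?f] conjI ballI allI impI)
    show "finite (?f v)" for v
      by (simp add: ones_of_def)
    show "inj_on ?f (verts G)"
    proof (rule inj_onI)
      fix u v
      assume uv: "u \<in> verts G" "v \<in> verts G" "?f u = ?f v"
      then have "g u = g v"
        using ones_of_inj len by metis
      then show "u = v"
        using uv bij by (auto simp: bij_betw_def dest: inj_onD)
    qed
    show "\<exists>u\<in>verts G. ?f u = S" if v: "v \<in> verts G" and S: "S \<subseteq> ?f v" for v S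
    proof -
      let ?w = "map (\<lambda>i. i \<in> S) [0..<h]"
      have "S \<subseteq> {..<h}"
        using S len[OF v] by (auto simp: ones_of_def)
      then have w: "ones_of ?w = S"
        by (rule ones_of_map)
      obtain x where x: "x \<in> X" "list_all2 (\<le>) (g v) x"
        using g[OF v] by blast
      then have "length x = h"
        using X by (auto simp: words_def)
      then have "list_all2 (\<le>) ?w x"
        using x(2) S w len[OF v] by (simp add: list_all2_le_iff)
      then have "?w \<in> ?D"
        using x(1) by (auto simp: words_def)
      then obtain u where "u \<in> verts G" "g u = ?w"
        using bij unfolding V bij_betw_def by (metis imageE)
      then show ?thesis
        using w by (intro bexI[of _ u]) simp_all
    qed
    show "{u, v} \<in> edges G \<longleftrightarrow> card (sym_diff (?f u) (?f v)) = 1"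
      if "u \<in> verts G" "v \<in> verts G" for u v
      using edge[OF that] E[OF g g] hamming_ones_of[of "g u" "g v"] len that by simp
  qed
qed

section \<open>Adjacency lists in arrays\<close>

lemma slice_list:
  assumes "distinct xs" "\<And>k. k < length xs \<Longrightarrow> A (l + k) = xs ! k"
  shows "slice A l (l + length xs) (set xs)"
proof -
  have A: "A j = xs ! (j - l)" if "l \<le> j" "j < l + length xs" for j
    using assms(2)[of "j - l"] that by simp
  have "inj_on A {l..<l + length xs}"
  proof (rule inj_onI)
    fix i j
    assume ij: "i \<in> {l..<l + length xs}" "j \<in> {l..<l + length xs}" "A i = A j"
    then have "xs ! (i - l) = xs ! (j - l)" "i - l < length xs" "j - l < length xs"
      using A by auto
    then have "i - l = j - l"
      using nth_eq_iff_index_eq[OF assms(1)] by blast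
    then show "i = j" using ij by auto
  qed
  moreover have "A ` {l..<l + length xs} = set xs"
  proof (intro equalityI subsetI)
    show "x \<in> set xs" if "x \<in> A ` {l..<l + length xs}" for x
      using that A by auto
    fix x
    assume "x \<in> set xs"
    then obtain k where "k < length xs" "x = xs ! k"
      by (auto simp: in_set_conv_nth)
    then show "x \<in> A ` {l..<l + length xs}"
      using assms(2)[of k] by (intro image_eqI[of _ _ "l + k"]) auto
  qed
  ultimately show ?thesis
    by (simp add: slice_def)
qed

lemma offsets_nth: "i \<le> length xss \<Longrightarrow> offsets xss ! i = length (concat (take i xss))"
  unfolding offsets_def by (subst nth_map) (simp_all del: upt_Suc)

lemma concat_split:
  assumes "i < length xss"
  shows "concat xss = concat (take i xss) @ xss ! i @ concat (drop (Suc i) xss)"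
proof -
  have "concat xss = concat (take i xss @ xss ! i # drop (Suc i) xss)"
    using id_take_nth_drop[OF assms] by simp
  then show ?thesis by simp
qed

lemma simple_graph_edge:
  assumes "simple_graph G" "{u, v} \<in> edges G"
  shows "v \<in> verts G"
proof -
  obtain a b where ab: "a \<in> verts G" "b \<in> verts G" "{u, v} = {a, b}"
    using assms unfolding simple_graph_def by blast
  have "v \<in> {u, v}" by simp
  then have "v \<in> {a, b}" unfolding ab(3) .
  then show ?thesis using ab(1,2) by auto
qed

text \<open>Handshake argument: an ordered pair of adjacent vertices is determined by its edge and
  one bit for the orientation.\<close>

lemma sum_degrees_le:
  assumes "simple_graph G" "verts G = {..<n::nat}"
  shows "(\<Sum>v<n. card {u. {v, u} \<in> edges G}) \<le> 2 * card (edges G)"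
proof -
  have sub: "{u. {v, u} \<in> edges G} \<subseteq> {..<n}" for v
    using simple_graph_edge[OF assms(1), of v] unfolding assms(2) by (intro subsetI) simp
  have "edges G \<subseteq> Pow (verts G)"
  proof
    fix e
    assume "e \<in> edges G"
    then obtain u v where "u \<in> verts G" "v \<in> verts G" "e = {u, v}"
      using assms(1) unfolding simple_graph_def by blast
    then show "e \<in> Pow (verts G)" by simp
  qed
  moreover have "finite (Pow (verts G))"
    by (simp add: assms(2))
  ultimately have fin: "finite (edges G)"
    by (rule finite_subset)
  let ?P = "Sigma {..<n} (\<lambda>v. {u. {v, u} \<in> edges G})"
  let ?g = "\<lambda>(v::nat, u). ({v, u}, v < u)"
  have "inj_on ?g ?P"
    by (rule inj_onI) (auto simp: doubleton_eq_iff)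
  moreover have "?g ` ?P \<subseteq> edges G \<times> (UNIV :: bool set)"
    by auto
  ultimately have "card ?P \<le> card (edges G \<times> (UNIV :: bool set))"
    using fin by (intro card_inj_on_le) auto
  then show ?thesis
    using sub finite_subset[OF sub] by (simp add: card_SigmaI card_cartesian_product mult.commute)
qed

context down_closed
begin

section \<open>Distances in the graph\<close>

lemma dd_triangle:
  assumes "u < n" "v < n" "w < n"
  shows "dd u w \<le> dd u v + dd v w"
proof -
  have "sep u w \<subseteq> sep u v \<union> sep v w"
    using sep_chain[of u w v] by blast
  then have "card (sep u w) \<le> card (sep u v \<union> sep v w)"
    using finite_sep assms by (intro card_mono) auto
  then show ?thesis
    unfolding dd_def using card_Un_le le_trans by blast
qed

text \<open>Walks cannot be shorter by the triangle inequality, applied edge by edge. Repeatedly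
  moving from \<open>v\<close> to a neighbour closer to \<open>u\<close> yields a walk of exactly
  this length.\<close>

lemma gdist_eq_dd:
  assumes V: "verts G = {..<n}"
    and E: "\<And>u v. u < n \<Longrightarrow> v < n \<Longrightarrow> {u, v} \<in> edges G \<longleftrightarrow> dd u v = 1"
    and uv: "u < n" "v < n"
  shows "gdist G u v = enat (dd u v)"
proof (rule antisym)
  have "dd u v \<le> length p - 1" if "walk G u p v" "u < n" for p u
    using that
  proof (induction p arbitrary: u)
    case Nil
    then show ?case by (simp add: walk_def)
  next
    case (Cons a p)
    then have a: "a = u" by (simp add: walk_def)
    show ?case
    proof (cases p)
      case Nil
      then have "u = v" using Cons.prems by (auto simp: walk_def)
      then show ?thesis by simp
    next
      case (Cons b q)
      have w: "walk G b p v" "b < n" "{u, b} \<in> edges G"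
        using \<open>walk G u (a # p) v\<close> V a Cons by (auto simp: walk_def)
      then have "dd u b = 1"
        using E \<open>u < n\<close> by blast
      then show ?thesis
        using dd_triangle[OF \<open>u < n\<close> w(2) uv(2)] Cons.IH[OF w(1,2)] Cons by simp
    qed
  qed
  then show "enat (dd u v) \<le> gdist G u v"
    unfolding gdist_def using uv by (intro INF_greatest) simp
  have "\<exists>p. walk G u p v \<and> length p = Suc (dd u v)"
    using uv(2)
  proof (induction "dd u v" arbitrary: v rule: less_induct)
    case less
    show ?case
    proof (cases "v = u")
      case True
      then have "walk G u [u] v \<and> length [u] = Suc (dd u v)"
        using V uv(1) by (simp add: walk_def)
      then show ?thesis by blast
    next
      case False
      then obtain w where w: "w \<in> down_nbrs u v"
        using down_nbr_exists[OF uv(1) less.prems] by blast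
      then have w': "w < n" "Suc (dd u w) = dd u v" "dd v w = 1"
        using down_nbrs_less[OF w] by (auto simp: down_nbrs_def nbrs_def)
      then obtain p where p: "walk G u p w" "length p = Suc (dd u w)"
        using less.hyps[of w] by auto
      have "{w, v} \<in> edges G"
        using E[OF w'(1) less.prems] w' by (simp add: dd_commute)
      have "walk G u (p @ [v]) v"
        unfolding walk_def
      proof (intro conjI allI impI)
        fix i
        assume "Suc i < length (p @ [v])"
        then consider "Suc i < length p" | "Suc i = length p" by fastforce
        then show "{(p @ [v]) ! i, (p @ [v]) ! Suc i} \<in> edges G"
        proof cases
          case 1
          then show ?thesis using p(1) by (simp add: walk_def nth_append)
        next
          case 2
          then have "p ! i = w"
            using p(1) by (metis walk_def last_conv_nth diff_Suc_1)
          then show ?thesis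
            using 2 \<open>{w, v} \<in> edges G\<close> by (simp add: nth_append)
        qed
      qed (use p(1) V less.prems in \<open>auto simp: walk_def\<close>)
      then show ?thesis
        using p(2) w'(2) by (intro exI[of _ "p @ [v]"]) simp
    qed
  qed
  then obtain p where p: "walk G u p v" "length p = Suc (dd u v)" by blast
  have "gdist G u v \<le> enat (length p - 1)"
    unfolding gdist_def using p(1) by (intro INF_lower) simp
  then show "gdist G u v \<le> enat (dd u v)"
    using p(2) by simp
qed

lemma isometric_central:
  assumes V: "verts G = {..<n}"
    and E: "\<And>u v. u < n \<Longrightarrow> v < n \<Longrightarrow> {u, v} \<in> edges G \<longleftrightarrow> dd u v = 1"
    and w: "central w"
  shows "isometric_embedding G n (\<lambda>v. map (\<lambda>k. k \<in> label w v) [0..<n])"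
proof -
  have ones: "ones_of (map (\<lambda>k. k \<in> label w v) [0..<n]) = label w v" for v
    using label_less by (intro ones_of_map) auto
  show ?thesis
    unfolding isometric_embedding_def V
    by (auto simp: words_def hamming_ones_of ones card_sym_diff_label[OF w] gdist_eq_dd[OF V E])
qed

lemma input_init_state:
  assumes len: "length adj = n" and adj: "\<And>v. v < n \<Longrightarrow> distinct (adj ! v) \<and> set (adj ! v) = nbrs v"
  shows "input (init_state adj)"
  unfolding input_def
proof (intro conjI allI impI)
  let ?s = "init_state adj"
  show "reg ?s 0 = n" by (simp add: init_state_def len)
  fix v
  assume v: "v < n"
  have off: "arr ?s 0 k = length (concat (take k adj))" if "k \<le> n" for k
    using that offsets_nth[of k adj] len by (simp add: init_state_def array_of_def offsets_def del: upt_Suc)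
  have "slice (arr ?s 1) (arr ?s 0 v) (arr ?s 0 v + length (adj ! v)) (set (adj ! v))"
  proof (rule slice_list)
    show "distinct (adj ! v)" using adj v by blast
    fix k
    assume "k < length (adj ! v)"
    then show "arr ?s 1 (arr ?s 0 v + k) = adj ! v ! k"
      using v concat_split[of v adj] len
      by (simp add: off) (simp add: init_state_def array_of_def nth_append)
  qed
  moreover have "arr ?s 0 (Suc v) = arr ?s 0 v + length (adj ! v)"
    using v len by (simp add: off take_Suc_conv_app_nth)
  ultimately show "slice (arr ?s 1) (arr ?s 0 v) (arr ?s 0 (Suc v)) (nbrs v)"
    using adj v by simp
qed

end

section \<open>Correctness and linear running time\<close>

lemma embed_correct:
  fixes G :: "nat graph" and adj :: "nat list list"
  assumes G: "simple_graph G" "is_daisy_cube G" "adjacency_lists G adj" and pos: "0 < length adj"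
  shows "\<exists>t s h \<alpha>. exec embed (init_state adj) t s \<and> t \<le> 248 * (card (edges G) + 1) \<and>
    isometric_embedding G h \<alpha> \<and> outputs_map s (length adj) h \<alpha>"
proof -
  let ?n = "length adj"
  have V: "verts G = {..<?n}"
    and adj: "\<And>u. u < ?n \<Longrightarrow> distinct (adj ! u) \<and> set (adj ! u) = {v. {u, v} \<in> edges G}"
    using G(3) by (auto simp: adjacency_lists_def)
  from daisy_cube_sets[OF G(2)] obtain f :: "nat \<Rightarrow> nat set" where
    f: "(\<forall>v \<in> verts G. finite (f v)) \<and> inj_on f (verts G) \<and>
    (\<forall>v \<in> verts G. \<forall>S \<subseteq> f v. \<exists>u \<in> verts G. f u = S) \<and>
    (\<forall>u \<in> verts G. \<forall>v \<in> verts G. {u, v} \<in> edges G \<longleftrightarrow> card (sym_diff (f u) (f v)) = 1)" ..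
  interpret down_closed ?n f
  proof
    show "\<exists>u<?n. f u = S" if "v < ?n" "S \<subseteq> f v" for v S
      using f that unfolding V by blast
  qed (use pos f in \<open>auto simp: V\<close>)
  have E: "{u, v} \<in> edges G \<longleftrightarrow> dd u v = 1" if "u < ?n" "v < ?n" for u v
    using f that unfolding V dd_def sep_def by blast
  have nb: "{v. {u, v} \<in> edges G} = nbrs u" if "u < ?n" for u
  proof -
    have "v < ?n" if "{u, v} \<in> edges G" for v
      using simple_graph_edge[OF G(1) that] V by simp
    then show ?thesis
      using E[OF that] unfolding nbrs_def by blast
  qed
  have "input (init_state adj)"
    by (rule input_init_state) (use adj nb in auto)
  then have "runs embed (init_state adj) (99 + 124 * total) (\<lambda>s'. reg s' 0 = ?n \<and>
    (\<exists>w ones. central w \<and> length ones = ?n \<and>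
      (\<forall>v<?n. distinct (ones ! v) \<and> set (ones ! v) = label w v) \<and> stored_lists s' 2 3 ones))"
    by (rule runs_embed) (simp add: init_state_def)
  then obtain t s w ones where t: "exec embed (init_state adj) t s" "t \<le> 99 + 124 * total"
    and s: "reg s 0 = ?n" "central w" "length ones = ?n" "stored_lists s 2 3 ones"
      "\<And>v. v < ?n \<Longrightarrow> distinct (ones ! v) \<and> set (ones ! v) = label w v"
    unfolding runs_def by blast
  \<comment> \<open>Hence \<open>99 + 124 * total\<close> is at most
    \<open>99 + 248 * card (edges G)\<close>, which explains the factor \<open>248\<close>.\<close>
  have "total \<le> 2 * card (edges G)"
    using sum_degrees_le[OF G(1) V] nb by (simp add: total_def)
  then have time: "t \<le> 248 * (card (edges G) + 1)"
    using t(2) unfolding distrib_left by linarith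
  let ?\<alpha> = "\<lambda>v. map (\<lambda>k. k \<in> label w v) [0..<?n]"
  have "isometric_embedding G ?n ?\<alpha>"
    by (rule isometric_central[OF V E s(2)])
  moreover have "outputs_map s ?n ?n ?\<alpha>"
    unfolding outputs_map_def using s label_less
    by (intro conjI exI[of _ ones]) auto
  ultimately show ?thesis
    using t(1) time by blast
qed

theorem theorem2:
  "\<exists>(P :: com) (c :: nat). \<forall>(G :: nat graph) (adj :: nat list list).
     simple_graph G \<and> is_daisy_cube G \<and> adjacency_lists G adj \<longrightarrow>
       (\<exists>t s h \<alpha>. exec P (init_state adj) t s \<and>
          t \<le> c * (card (edges G) + 1) \<and>
          isometric_embedding G h \<alpha> \<and>
          outputs_map s (length adj) h \<alpha>)"
proof (rule exI[of _ embed], rule exI[of _ 248], intro allI impI)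
  fix G :: "nat graph" and adj :: "nat list list"
  assume G: "simple_graph G \<and> is_daisy_cube G \<and> adjacency_lists G adj"
  show "\<exists>t s h \<alpha>. exec embed (init_state adj) t s \<and> t \<le> 248 * (card (edges G) + 1) \<and>
    isometric_embedding G h \<alpha> \<and> outputs_map s (length adj) h \<alpha>"
  proof (cases "adj = []")
    case True
    have "exec embed (init_state adj) (1 + 1) (init_state adj)"
      unfolding embed_def by (rule exec.IteFalse) (simp_all add: True init_state_def exec.Skip)
    moreover have "isometric_embedding G 0 (\<lambda>_. [])"
      using G True by (simp add: isometric_embedding_def adjacency_lists_def)
    \<comment> \<open>\<open>offsets []\<close> is \<open>[0]\<close>, which the zero-initialised
      array 2 already stores.\<close>
    moreover have "outputs_map (init_state adj) (length adj) 0 (\<lambda>_. [])"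
      unfolding outputs_map_def
      by (simp add: True init_state_def stored_lists_def offsets_def)
    ultimately show ?thesis
      by (intro exI[of _ "1 + 1"] exI conjI) auto
  next
    case False
    then show ?thesis
      using embed_correct G by simp
  qed
qed

end
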